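(* Consider the feasible trust region iteration described in the context, assume it generates an infinite sequence $\{x_t\}$, and suppose $x_t\to x^*$. Let $\lambda^*=\nabla f(x^* )^{\mathrm T}x^*$, $g^*=\nabla f(x^* )-\lambda^*\nabla c(x^* )$, $W^*=\nabla^2f(x^* )-\lambda^*\nabla^2c(x^* )$, and $\mathcal{I}(x^* )=\{i: x^*[i]=0\}$. Then the second-order necessary condition holds: $d^{\mathrm T}W^*d\ge0$ for all $d\in\mathcal{C}(x^*,\lambda^* )$, where $\mathcal{C}(x^*,\lambda^* )=\{d\in\mathbb{R}^{n-1}: \nabla c(x^* )^{\mathrm T}d=0;\ d[i]=0\ \forall i\in\mathcal{I}(x^* )\text{ with }g^*[i]>0;\ d[i]\ge0\ \forall i\in\mathcal{I}(x^* )\text{ with }g^*[i]=0\}$.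
   Context: Let $k\ge3$, let $G$ be a $k$-uniform hypergraph on $[n]$ with Laplacian tensor $\mathcal{L}$ (so $\mathcal{L}x^k=\sum_{e\in E}(\sum_{i\in e}x[i]^k-k\prod_{i\in e}x[i])$; $\mathcal{L}$ is a symmetric tensor), fix $j\in[n]$, and let $\tilde{\mathcal{L}}$ be the $k$-th order $(n-1)$-dimensional principal subtensor of $\mathcal{L}$ indexed by $[n]\setminus\{j\}$. For $x\in\mathbb{R}^{n-1}$ let $f(x)=\frac1k\tilde{\mathcal{L}}x^k$ and $c(x)=\frac1k(\sum_{i=1}^{n-1}x[i]^k-1)$; then $\nabla f(x)=\tilde{\mathcal{L}}x^{k-1}$, $\nabla^2f(x)=(k-1)\tilde{\mathcal{L}}x^{k-2}$, $\nabla c(x)=x^{[k-1]}=(x[i]^{k-1})_i$, $\nabla^2c(x)=(k-1)\mathrm{diag}(x^{[k-2]})$. Let $\|x\|_k=(\sum_i|x[i]|^k)^{1/k}$ and $P(x)=x/\|x\|_k$. Iteration: choose parameters $0<\sigma_0<\sigma_1<\sigma_2$ with $\sigma_1<1$, $0<\Delta_0\le\Delta_{\max}$, and $x_0\ge0$ with $\|x_0\|_k=1$. At step $t$, set $\lambda_t=\nabla f(x_t)^{\mathrm T}x_t$, $g_t=\nabla f(x_t)-\lambda_t\nabla c(x_t)$, $W_t=\nabla^2f(x_t)-\lambda_t\nabla^2c(x_t)$, $m_t(d)=f(x_t)+g_t^{\mathrm T}d+\frac12d^{\mathrm T}W_td$, and let $d_t$ be a global minimizer of $m_t(d)$ subject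 to $\nabla c(x_t)^{\mathrm T}d=0$, $\|d\|_\infty\le\Delta_t$, $x_t+d\ge0$. Set $\rho_t=\frac{f(x_t)-f(P(x_t+d_t))}{m_t(0)-m_t(d_t)}$. Update $\Delta_{t+1}=\frac12\Delta_t$ if $\rho_t\le\sigma_1$, $\Delta_{t+1}=\min(\Delta_{\max},2\Delta_t)$ if $\rho_t>\sigma_2$, and $\Delta_{t+1}=\Delta_t$ otherwise; set $x_{t+1}=P(x_t+d_t)$ if $\rho_t\ge\sigma_0$ and $x_{t+1}=x_t$ otherwise. (The algorithm would stop when $\|d_t\|\le\epsilon$; here it is assumed never to stop.) *)

theory Defs
  imports "HOL-Analysis.Analysis" "HOL-Combinatorics.Multiset_Permutations"
begin

text \<open>
  Vectors of \<open>\<real>\<^sup>I\<close>, for a finite index set \<open>I\<close> of natural numbers, are functions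
  \<open>nat \<Rightarrow> real\<close> of which only the values on \<open>I\<close> are ever used. In particular the space
  of dimension \<open>n - 1\<close> is indexed by \<open>{1..n} - {j}\<close> itself, without renumbering.
\<close>

definition dotp :: "nat set \<Rightarrow> (nat \<Rightarrow> real) \<Rightarrow> (nat \<Rightarrow> real) \<Rightarrow> real" where
  "dotp I u v = (\<Sum>i\<in>I. u i * v i)"

definition quad_form :: "nat set \<Rightarrow> (nat \<Rightarrow> nat \<Rightarrow> real) \<Rightarrow> (nat \<Rightarrow> real) \<Rightarrow> real" where
  "quad_form I W d = (\<Sum>i\<in>I. \<Sum>l\<in>I. d i * W i l * d l)"

definition grad :: "((nat \<Rightarrow> real) \<Rightarrow> real) \<Rightarrow> (nat \<Rightarrow> real) \<Rightarrow> nat \<Rightarrow> real" where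
  "grad f x i = deriv (\<lambda>s. f (x(i := s))) (x i)"

definition hess :: "((nat \<Rightarrow> real) \<Rightarrow> real) \<Rightarrow> (nat \<Rightarrow> real) \<Rightarrow> nat \<Rightarrow> nat \<Rightarrow> real" where
  "hess f x i l = grad (\<lambda>y. grad f y i) x l"


section \<open>Hypergraphs and the Laplacian tensor\<close>

definition uniform_hypergraph :: "nat \<Rightarrow> nat \<Rightarrow> nat set set \<Rightarrow> bool" where
  "uniform_hypergraph n k E \<longleftrightarrow> (\<forall>e\<in>E. e \<subseteq> {1..n} \<and> card e = k)"

definition degree :: "nat set set \<Rightarrow> nat \<Rightarrow> nat" where
  "degree E i = card {e \<in> E. i \<in> e}"

text \<open>
  A tensor of order \<open>k\<close> assigns an entry to each index list of length \<open>k\<close>. The Laplacian tensor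
  is the diagonal degree tensor minus the adjacency tensor, whose entry at \<open>[i\<^sub>1, \<dots>, i\<^sub>k]\<close> is
  \<open>1 / (k - 1)!\<close> if \<open>{i\<^sub>1, \<dots>, i\<^sub>k}\<close> is an edge and \<open>0\<close> otherwise.
\<close>

definition laplacian_tensor :: "nat \<Rightarrow> nat set set \<Rightarrow> nat list \<Rightarrow> real" where
  "laplacian_tensor k E is =
     (if is = replicate k (hd is) then real (degree E (hd is)) else 0)
     - (if set is \<in> E then 1 / fact (k - 1) else 0)"

text \<open>
  \<open>tensor_apply I T m x\<close> is \<open>T x\<^sup>m\<close> for the principal subtensor of \<open>T\<close> indexed by \<open>I\<close>: the last
  \<open>m\<close> indices range over \<open>I\<close> and are contracted with \<open>x\<close>; the remaining indices form the list
  \<open>js\<close>. With \<open>T\<close> of order \<open>k\<close>, \<open>m = k\<close> gives a scalar (at \<open>js = []\<close>), \<open>m = k - 1\<close> a vector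
  (at \<open>js = [i]\<close>) and \<open>m = k - 2\<close> a matrix (at \<open>js = [i, l]\<close>).
\<close>

definition tensor_apply ::
  "nat set \<Rightarrow> (nat list \<Rightarrow> real) \<Rightarrow> nat \<Rightarrow> (nat \<Rightarrow> real) \<Rightarrow> nat list \<Rightarrow> real" where
  "tensor_apply I T m x js =
     (\<Sum>is \<in> {is. set is \<subseteq> I \<and> length is = m}. T (js @ is) * prod_list (map x is))"

definition lap_fun :: "nat \<Rightarrow> nat set set \<Rightarrow> nat set \<Rightarrow> (nat \<Rightarrow> real) \<Rightarrow> real" where
  "lap_fun k E I x = 1 / real k * tensor_apply I (laplacian_tensor k E) k x []"

definition sphere_con :: "nat \<Rightarrow> nat set \<Rightarrow> (nat \<Rightarrow> real) \<Rightarrow> real" where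
  "sphere_con k I x = 1 / real k * ((\<Sum>i\<in>I. x i ^ k) - 1)"

definition knorm :: "nat \<Rightarrow> nat set \<Rightarrow> (nat \<Rightarrow> real) \<Rightarrow> real" where
  "knorm k I x = root k (\<Sum>i\<in>I. \<bar>x i\<bar> ^ k)"

definition kproj :: "nat \<Rightarrow> nat set \<Rightarrow> (nat \<Rightarrow> real) \<Rightarrow> nat \<Rightarrow> real" where
  "kproj k I x = (\<lambda>i. x i / knorm k I x)"


section \<open>The feasible trust region iteration\<close>

definition multiplier :: "nat set \<Rightarrow> ((nat \<Rightarrow> real) \<Rightarrow> real) \<Rightarrow> (nat \<Rightarrow> real) \<Rightarrow> real" where
  "multiplier I f x = dotp I (grad f x) x"

definition lag_grad ::
  "((nat \<Rightarrow> real) \<Rightarrow> real) \<Rightarrow> ((nat \<Rightarrow> real) \<Rightarrow> real) \<Rightarrow> real \<Rightarrow> (nat \<Rightarrow> real) \<Rightarrow> nat \<Rightarrow> real" where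
  "lag_grad f c lam x = (\<lambda>i. grad f x i - lam * grad c x i)"

definition lag_hess ::
  "((nat \<Rightarrow> real) \<Rightarrow> real) \<Rightarrow> ((nat \<Rightarrow> real) \<Rightarrow> real) \<Rightarrow> real \<Rightarrow> (nat \<Rightarrow> real) \<Rightarrow> nat \<Rightarrow> nat \<Rightarrow> real" where
  "lag_hess f c lam x = (\<lambda>i l. hess f x i l - lam * hess c x i l)"

definition tr_model ::
  "nat set \<Rightarrow> ((nat \<Rightarrow> real) \<Rightarrow> real) \<Rightarrow> ((nat \<Rightarrow> real) \<Rightarrow> real) \<Rightarrow> (nat \<Rightarrow> real) \<Rightarrow> (nat \<Rightarrow> real) \<Rightarrow> real"
where
  "tr_model I f c x d =
     f x + dotp I (lag_grad f c (multiplier I f x) x) d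
     + 1 / 2 * quad_form I (lag_hess f c (multiplier I f x) x) d"

definition tr_feasible ::
  "nat set \<Rightarrow> ((nat \<Rightarrow> real) \<Rightarrow> real) \<Rightarrow> (nat \<Rightarrow> real) \<Rightarrow> real \<Rightarrow> (nat \<Rightarrow> real) \<Rightarrow> bool" where
  "tr_feasible I c x \<Delta> d \<longleftrightarrow>
     dotp I (grad c x) d = 0 \<and> (\<forall>i\<in>I. \<bar>d i\<bar> \<le> \<Delta>) \<and> (\<forall>i\<in>I. 0 \<le> x i + d i)"

definition tr_minimizer ::
  "nat set \<Rightarrow> ((nat \<Rightarrow> real) \<Rightarrow> real) \<Rightarrow> ((nat \<Rightarrow> real) \<Rightarrow> real) \<Rightarrow> (nat \<Rightarrow> real) \<Rightarrow> real \<Rightarrow> (nat \<Rightarrow> real) \<Rightarrow> bool"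
where
  "tr_minimizer I f c x \<Delta> d \<longleftrightarrow>
     tr_feasible I c x \<Delta> d \<and>
     (\<forall>d'. tr_feasible I c x \<Delta> d' \<longrightarrow> tr_model I f c x d \<le> tr_model I f c x d')"

definition tr_ratio ::
  "nat \<Rightarrow> nat set \<Rightarrow> ((nat \<Rightarrow> real) \<Rightarrow> real) \<Rightarrow> ((nat \<Rightarrow> real) \<Rightarrow> real) \<Rightarrow> (nat \<Rightarrow> real) \<Rightarrow> (nat \<Rightarrow> real) \<Rightarrow> real"
where
  "tr_ratio k I f c x d =
     (f x - f (kproj k I (\<lambda>i. x i + d i))) / (tr_model I f c x (\<lambda>_. 0) - tr_model I f c x d)"

text \<open>
  \<open>x\<close>, \<open>d\<close> and \<open>\<Delta>\<close> are the sequences of iterates, steps and radii of a run that never meets the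
  stopping test \<open>\<parallel>d\<^sub>t\<parallel> \<le> \<epsilon>\<close>. Global minimizers of the subproblem need not be unique, so a run
  is described by a predicate. If the predicted decrease is \<open>0\<close>, the ratio is \<open>0\<close> (division by
  zero) and the step is rejected.
\<close>

definition ftr_run ::
  "nat \<Rightarrow> nat set \<Rightarrow> ((nat \<Rightarrow> real) \<Rightarrow> real) \<Rightarrow> ((nat \<Rightarrow> real) \<Rightarrow> real) \<Rightarrow>
   real \<Rightarrow> real \<Rightarrow> real \<Rightarrow> real \<Rightarrow> real \<Rightarrow>
   (nat \<Rightarrow> nat \<Rightarrow> real) \<Rightarrow> (nat \<Rightarrow> nat \<Rightarrow> real) \<Rightarrow> (nat \<Rightarrow> real) \<Rightarrow> bool"
where
  "ftr_run k I f c \<sigma>0 \<sigma>1 \<sigma>2 \<Delta>max \<epsilon> x d \<Delta> \<longleftrightarrow>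
     (\<forall>i\<in>I. 0 \<le> x 0 i) \<and> knorm k I (x 0) = 1 \<and>
     0 < \<Delta> 0 \<and> \<Delta> 0 \<le> \<Delta>max \<and>
     (\<forall>t. tr_minimizer I f c (x t) (\<Delta> t) (d t) \<and>
          \<epsilon> < L2_set (d t) I \<and>
          (let \<rho> = tr_ratio k I f c (x t) (d t) in
             \<Delta> (Suc t) = (if \<rho> \<le> \<sigma>1 then 1 / 2 * \<Delta> t
                           else if \<rho> > \<sigma>2 then min \<Delta>max (2 * \<Delta> t)
                           else \<Delta> t) \<and>
             (\<forall>i\<in>I. x (Suc t) i = (if \<rho> \<ge> \<sigma>0 then kproj k I (\<lambda>l. x t l + d t l) i else x t i))))"

definition critical_cone ::
  "nat set \<Rightarrow> ((nat \<Rightarrow> real) \<Rightarrow> real) \<Rightarrow> ((nat \<Rightarrow> real) \<Rightarrow> real) \<Rightarrow> (nat \<Rightarrow> real) \<Rightarrow> real \<Rightarrow> (nat \<Rightarrow> real) set"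
where
  "critical_cone I f c x lam =
     {d. dotp I (grad c x) d = 0 \<and>
         (\<forall>i\<in>I. x i = 0 \<and> lag_grad f c lam x i > 0 \<longrightarrow> d i = 0) \<and>
         (\<forall>i\<in>I. x i = 0 \<and> lag_grad f c lam x i = 0 \<longrightarrow> d i \<ge> 0)}"


section \<open>The defined notions satisfy the usual formulas\<close>

lemma laplacian_tensor_sym:
  assumes "mset is = mset js" "k > 0" "length is = k"
  shows "laplacian_tensor k E is = laplacian_tensor k E js"
proof -
  have s: "set is = set js" and l: "length js = k"
    using assms by (metis mset_eq_setD, metis mset_eq_length)
  have rep: "ls = replicate k (hd ls) \<longleftrightarrow> (\<exists>a. set ls = {a})" if "length ls = k" for ls :: "nat list"
    using that assms(2)
    by (metis list.sel(1) list.set_sel(1) replicate_eqI set_replicate singletonD length_0_conv not_gr_zero)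
  have "hd is = hd js" if "set is = {a}" for a
    using that s assms(2,3) l by (metis list.set_sel(1) singletonD set_empty insert_not_empty)
  then show ?thesis
    unfolding laplacian_tensor_def rep[OF assms(3)] rep[OF l] using s by auto
qed

lemma tensor_apply_0 [simp]: "tensor_apply I T 0 x js = T js"
proof -
  have "{is. set is \<subseteq> I \<and> length is = 0} = {[]}" by auto
  then show ?thesis by (simp add: tensor_apply_def)
qed

lemma tensor_apply_Suc:
  assumes "finite I"
  shows "tensor_apply I T (Suc m) x js = (\<Sum>a\<in>I. x a * tensor_apply I T m x (js @ [a]))"
proof -
  let ?L = "\<lambda>m. {is. set is \<subseteq> I \<and> length is = m}"
  have eq: "?L (Suc m) = (\<lambda>(a, is). a # is) ` (I \<times> ?L m)"
    by (auto simp: length_Suc_conv image_iff) 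
  have inj: "inj_on (\<lambda>(a, is). a # is) (I \<times> ?L m)"
    by (auto simp: inj_on_def)
  have "tensor_apply I T (Suc m) x js =
        (\<Sum>(a, is)\<in>I \<times> ?L m. T (js @ a # is) * (x a * prod_list (map x is)))"
    unfolding tensor_apply_def eq sum.reindex[OF inj] by (intro sum.cong) auto
  also have "\<dots> = (\<Sum>a\<in>I. x a * tensor_apply I T m x (js @ [a]))"
    unfolding tensor_apply_def sum.cartesian_product[symmetric]
    by (intro sum.cong refl) (simp add: sum_distrib_left mult_ac)
  finally show ?thesis .
qed

lemma tensor_apply_cong:
  assumes "\<And>is. \<lbrakk>set is \<subseteq> I; length is = m\<rbrakk> \<Longrightarrow> T (js @ is) = T (js' @ is)"
  shows "tensor_apply I T m x js = tensor_apply I T m x js'"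
  unfolding tensor_apply_def using assms by (intro sum.cong) auto

lemma tensor_apply_DERIV:
  assumes "finite I" "i \<in> I"
    and sym: "\<And>is js. \<lbrakk>mset is = mset js; length is = k\<rbrakk> \<Longrightarrow> T is = T js"
    and "length js + m = k"
  shows "((\<lambda>s. tensor_apply I T m (x(i := s)) js) has_field_derivative
           real m * tensor_apply I T (m - 1) (x(i := s)) (js @ [i])) (at s)"
  using assms(4)
proof (induction m arbitrary: js)
  case 0
  then show ?case by simp
next
  case (Suc m)
  let ?x = "x(i := s)"
  let ?A = "\<lambda>m. tensor_apply I T m ?x"
  have coord: "((\<lambda>s. (x(i := s)) a) has_field_derivative (if a = i then 1 else 0)) (at s)" for a
    by (cases "a = i") auto
  have "((\<lambda>s. tensor_apply I T (Suc m) (x(i := s)) js) has_field_derivative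
          (\<Sum>a\<in>I. (if a = i then 1 else 0) * ?A m (js @ [a])
                  + real m * ?A (m - 1) ((js @ [a]) @ [i]) * ?x a)) (at s)"
    unfolding tensor_apply_Suc[OF assms(1)]
    by (intro DERIV_sum DERIV_mult coord Suc.IH) (use Suc.prems in auto)
  also have "(\<Sum>a\<in>I. (if a = i then 1 else 0) * ?A m (js @ [a])
                  + real m * ?A (m - 1) ((js @ [a]) @ [i]) * ?x a)
      = ?A m (js @ [i]) + real m * (\<Sum>a\<in>I. ?x a * ?A (m - 1) ((js @ [a]) @ [i]))"
  proof -
    have "(\<Sum>a\<in>I. (if a = i then 1 else 0) * ?A m (js @ [a])) = (\<Sum>a\<in>I. if a = i then ?A m (js @ [a]) else 0)"
      by (intro sum.cong) auto
    also have "\<dots> = ?A m (js @ [i])"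
      using assms(1,2) by simp
    finally show ?thesis
      by (simp add: sum.distrib sum_distrib_left mult_ac)
  qed
  also have "\<dots> = real (Suc m) * ?A m (js @ [i])"
  proof (cases m)
    case 0
    then show ?thesis by simp
  next
    case (Suc m')
    have "?A m' ((js @ [a]) @ [i]) = ?A m' ((js @ [i]) @ [a])" for a
      by (rule tensor_apply_cong, rule sym) (use Suc.prems Suc in auto)
    then have "(\<Sum>a\<in>I. ?x a * ?A (m - 1) ((js @ [a]) @ [i])) = ?A m (js @ [i])"
      unfolding Suc tensor_apply_Suc[OF assms(1)] by simp
    then show ?thesis by (simp add: algebra_simps)
  qed
  finally show ?case by (simp only: diff_Suc_1)
qed

lemma grad_tensor_apply:
  assumes "finite I" "i \<in> I"
    and "\<And>is js. \<lbrakk>mset is = mset js; length is = k\<rbrakk> \<Longrightarrow> T is = T js"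
    and "length js + m = k"
  shows "grad (\<lambda>x. a * tensor_apply I T m x js) x i = a * (real m * tensor_apply I T (m - 1) x (js @ [i]))"
proof -
  have "((\<lambda>s. tensor_apply I T m (x(i := s)) js) has_field_derivative
          real m * tensor_apply I T (m - 1) (x(i := x i)) (js @ [i])) (at (x i))"
    by (rule tensor_apply_DERIV) (use assms in auto)
  then show ?thesis
    unfolding grad_def fun_upd_triv by (intro DERIV_imp_deriv DERIV_cmult)
qed

lemma grad_lap_fun:
  assumes "finite I" "i \<in> I" "k > 0"
  shows "grad (lap_fun k E I) x i = tensor_apply I (laplacian_tensor k E) (k - 1) x [i]"
proof -
  have "lap_fun k E I = (\<lambda>x. 1 / real k * tensor_apply I (laplacian_tensor k E) k x [])"
    by (simp add: lap_fun_def fun_eq_iff)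
  then show ?thesis
    using grad_tensor_apply[OF assms(1,2), where T = "laplacian_tensor k E" and k = k and m = k
        and js = "[]" and a = "1 / real k" and x = x] laplacian_tensor_sym[OF _ assms(3)] assms(3)
    by simp
qed

lemma hess_lap_fun:
  assumes "finite I" "i \<in> I" "l \<in> I" "k > 0"
  shows "hess (lap_fun k E I) x i l
           = (real k - 1) * tensor_apply I (laplacian_tensor k E) (k - 2) x [i, l]"
  unfolding hess_def grad_lap_fun[OF assms(1,2,4)]
  using grad_tensor_apply[OF assms(1,3), where T = "laplacian_tensor k E" and k = k and m = "k - 1"
      and js = "[i]" and a = 1 and x = x] laplacian_tensor_sym[OF _ assms(4)] assms(4)
  by (simp add: of_nat_diff numeral_2_eq_2)

lemma grad_sphere_con:
  assumes "finite I" "i \<in> I" "k > 0"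
  shows "grad (sphere_con k I) x i = x i ^ (k - 1)"
proof -
  have "((\<lambda>s. \<Sum>a\<in>I. (x(i := s)) a ^ k) has_field_derivative
          (\<Sum>a\<in>I. if a = i then real k * x i ^ (k - 1) else 0)) (at (x i))"
    by (intro DERIV_sum) (auto intro!: derivative_eq_intros)
  then have "((\<lambda>s. 1 / real k * ((\<Sum>a\<in>I. (x(i := s)) a ^ k) - 1)) has_field_derivative
          1 / real k * ((\<Sum>a\<in>I. if a = i then real k * x i ^ (k - 1) else 0) - 0)) (at (x i))"
    by (intro DERIV_cmult DERIV_diff DERIV_const)
  then show ?thesis
    unfolding grad_def sphere_con_def using assms by (intro DERIV_imp_deriv) simp
qed

lemma hess_sphere_con:
  assumes "finite I" "i \<in> I" "k > 0"
  shows "hess (sphere_con k I) x i l = (if l = i then (real k - 1) * x i ^ (k - 2) else 0)"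
proof -
  have "((\<lambda>s. (x(l := s)) i ^ (k - 1)) has_field_derivative
          (if l = i then (real k - 1) * x i ^ (k - 2) else 0)) (at (x l))"
    using assms(3) by (auto intro!: derivative_eq_intros simp: of_nat_diff numeral_2_eq_2)
  then show ?thesis
    unfolding hess_def grad_sphere_con[OF assms] unfolding grad_def by (rule DERIV_imp_deriv)
qed

lemma laplacian_tensor_form:
  assumes "finite I" "finite E" "k > 0" "\<And>e. e \<in> E \<Longrightarrow> card e = k"
  shows "tensor_apply I (laplacian_tensor k E) k x [] =
           (\<Sum>i\<in>I. real (degree E i) * x i ^ k) - (\<Sum>e\<in>{e\<in>E. e \<subseteq> I}. real k * (\<Prod>i\<in>e. x i))"
proof -
  let ?L = "{is. set is \<subseteq> I \<and> length is = k}"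
  have fin: "finite ?L" using assms(1) by (rule finite_lists_length_eq)
  let ?p = "\<lambda>is. prod_list (map x is)"
  have "tensor_apply I (laplacian_tensor k E) k x [] =
     (\<Sum>is\<in>?L. if is = replicate k (hd is) then real (degree E (hd is)) * ?p is else 0)
     - (\<Sum>is\<in>?L. if set is \<in> E then 1 / fact (k - 1) * ?p is else 0)"
    unfolding tensor_apply_def laplacian_tensor_def sum_subtractf[symmetric]
    by (intro sum.cong) (auto simp: algebra_simps)
  also have "(\<Sum>is\<in>?L. if is = replicate k (hd is) then real (degree E (hd is)) * ?p is else 0)
     = (\<Sum>is\<in>(\<lambda>i. replicate k i) ` I. real (degree E (hd is)) * ?p is)"
  proof -
    have "{is \<in> ?L. is = replicate k (hd is)} = (\<lambda>i. replicate k i) ` I" (is "?A = ?B")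
    proof
      show "?A \<subseteq> ?B"
      proof
        fix ls assume "ls \<in> ?A"
        then have "ls = replicate k (hd ls)" "set ls \<subseteq> I" "ls \<noteq> []" using assms(3) by auto
        then show "ls \<in> ?B" by (metis hd_in_set image_eqI subsetD)
      qed
      show "?B \<subseteq> ?A" using assms(3) by auto
    qed
    then show ?thesis using fin by (simp add: sum.inter_filter[symmetric])
  qed
  also have "\<dots> = (\<Sum>i\<in>I. real (degree E i) * x i ^ k)"
  proof -
    have "inj_on (\<lambda>i. replicate k i) I"
      using assms(3) by (auto simp: inj_on_def replicate_eq_replicate)
    then show ?thesis using assms(3) by (simp add: sum.reindex prod_list_replicate)
  qed
  also have "(\<Sum>is\<in>?L. if set is \<in> E then 1 / fact (k - 1) * ?p is else 0)
     = (\<Sum>e\<in>{e\<in>E. e \<subseteq> I}. real k * (\<Prod>i\<in>e. x i))"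
  proof -
    have fe: "finite e" if "e \<in> E" for e
      using assms(3,4) that by (metis card.infinite less_irrefl)
    have "(\<Sum>is\<in>?L. if set is \<in> E then 1 / fact (k - 1) * ?p is else 0)
      = (\<Sum>is\<in>{is\<in>?L. set is \<in> E}. 1 / fact (k - 1) * ?p is)"
      by (rule sum.inter_filter[OF fin, symmetric])
    also have "{is\<in>?L. set is \<in> E} = (\<Union>e\<in>{e\<in>E. e \<subseteq> I}. permutations_of_set e)"
      using assms(4)
      by (auto simp: permutations_of_set_def distinct_card[symmetric] intro!: card_distinct)
    also have "(\<Sum>is\<in>\<dots>. 1 / fact (k - 1) * ?p is)
      = (\<Sum>e\<in>{e\<in>E. e \<subseteq> I}. \<Sum>is\<in>permutations_of_set e. 1 / fact (k - 1) * ?p is)"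
      using assms(2)
      by (intro sum.UNION_disjoint ballI finite_permutations_of_set) (auto simp: permutations_of_set_def)
    also have "\<dots> = (\<Sum>e\<in>{e\<in>E. e \<subseteq> I}. real k * (\<Prod>i\<in>e. x i))"
    proof (intro sum.cong refl)
      fix e assume e: "e \<in> {e\<in>E. e \<subseteq> I}"
      have "(\<Sum>is\<in>permutations_of_set e. 1 / fact (k - 1) * ?p is)
        = (\<Sum>is\<in>permutations_of_set e. 1 / fact (k - 1) * (\<Prod>i\<in>e. x i))"
        by (intro sum.cong refl) (auto simp: permutations_of_set_def prod.distinct_set_conv_list)
      also have "\<dots> = fact k / fact (k - 1) * (\<Prod>i\<in>e. x i)"
        using e fe assms(4) by simp
      also have "fact k / fact (k - 1) = real k"
        using assms(3) by (simp add: fact_reduce)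
      finally show "(\<Sum>is\<in>permutations_of_set e. 1 / fact (k - 1) * ?p is) = real k * (\<Prod>i\<in>e. x i)" .
    qed
    finally show ?thesis .
  qed
  finally show ?thesis .
qed

lemma laplacian_tensor_form_full:
  assumes "uniform_hypergraph n k E" "k > 0"
  shows "tensor_apply {1..n} (laplacian_tensor k E) k x [] =
           (\<Sum>e\<in>E. (\<Sum>i\<in>e. x i ^ k) - real k * (\<Prod>i\<in>e. x i))"
proof -
  have sub: "E \<subseteq> Pow {1..n}" using assms(1) by (auto simp: uniform_hypergraph_def)
  have fin: "finite E" using sub by (rule finite_subset) simp
  have "(\<Sum>i\<in>{1..n}. real (degree E i) * x i ^ k) = (\<Sum>i\<in>{1..n}. \<Sum>e\<in>E. if i \<in> e then x i ^ k else 0)"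
    using fin by (intro sum.cong) (auto simp: degree_def sum.inter_filter[symmetric])
  also have "\<dots> = (\<Sum>e\<in>E. \<Sum>i\<in>{1..n}. if i \<in> e then x i ^ k else 0)"
    by (rule sum.swap)
  also have "\<dots> = (\<Sum>e\<in>E. \<Sum>i\<in>e. x i ^ k)"
  proof (rule sum.cong[OF refl])
    fix e assume "e \<in> E"
    then have "e \<subseteq> {1..n}" using sub by blast
    then have "{i \<in> {1..n}. i \<in> e} = e" by blast
    then show "(\<Sum>i\<in>{1..n}. if i \<in> e then x i ^ k else 0) = (\<Sum>i\<in>e. x i ^ k)"
      using sum.inter_filter[of "{1..n}" "\<lambda>i. x i ^ k" "\<lambda>i. i \<in> e"] by simp
  qed
  finally have deg: "(\<Sum>i\<in>{1..n}. real (degree E i) * x i ^ k) = (\<Sum>e\<in>E. \<Sum>i\<in>e. x i ^ k)" .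
  have "{e\<in>E. e \<subseteq> {1..n}} = E" using sub by auto
  then show ?thesis
    using laplacian_tensor_form[of "{1..n}" E k x] fin assms deg
    by (simp add: uniform_hypergraph_def sum_subtractf)
qed

end

theory Submission
  imports Defs
begin

text \<open>
  Write \<open>W(y) = \<nabla>\<^sup>2f(y) - \<lambda>(y) \<nabla>\<^sup>2c(y)\<close>. For \<open>y \<ge> 0\<close> its off-diagonal entries are nonpositive, its
  diagonal entries vanish where \<open>y\<close> does (as \<open>k \<ge> 3\<close>), and \<open>W(y) y = (k - 1) g(y)\<close> by homogeneity.

  Homogeneity also gives \<open>f(P(y)) = f(y) / \<parallel>y\<parallel>\<^sub>k\<^sup>k\<close>, so that the model predicts the decrease of
  \<open>f\<close> up to an error cubic in the radius. Hence the model decrease cannot be at least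
  \<open>\<kappa> min(s\<^sub>0, \<Delta>\<^sub>t)\<^sup>2\<close> for all large \<open>t\<close>.

  Coordinate directions \<open>\<plusminus>e\<^sub>i\<close> therefore yield \<open>g\<^sup>* \<ge> 0\<close>, with equality where \<open>x\<^sup>* > 0\<close>; where
  \<open>x\<^sup>*\<close> vanishes, the sign pattern of \<open>W\<^sup>*\<close> gives \<open>g\<^sup>* \<le> 0\<close>. So \<open>W\<^sup>* x\<^sup>* = 0\<close>, which forces
  \<open>W\<^sup>*[i,l] = 0\<close> if exactly one of \<open>x\<^sup>*[i]\<close>, \<open>x\<^sup>*[l]\<close> is \<open>0\<close>. If both vanish and
  \<open>W\<^sup>*[i,l] < 0\<close>, then \<open>g\<^sub>t[i] + g\<^sub>t[l] \<le> 0\<close> eventually, and \<open>e\<^sub>i + e\<^sub>l\<close> would be a direction of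
  uniform quadratic decrease. Thus \<open>W\<^sup>*\<close> lives on the support of \<open>x\<^sup>*\<close>, where
  \<open>v\<^sup>T W\<^sup>* v = - 1/2 \<Sum>\<^sub>i\<^sub>l W\<^sup>*[i,l] x\<^sup>*[i] x\<^sup>*[l] (v[i] / x\<^sup>*[i] - v[l] / x\<^sup>*[l])\<^sup>2 \<ge> 0\<close>.
\<close>

section \<open>Taylor expansion of tensor forms\<close>

lemma tensor_apply_cong_arg:
  assumes "\<And>i. i \<in> I \<Longrightarrow> x i = y i"
  shows "tensor_apply I T m x js = tensor_apply I T m y js"
proof -
  have "prod_list (map x is) = prod_list (map y is)" if "set is \<subseteq> I" for "is"
    using that assms by (intro arg_cong[of _ _ prod_list] map_cong) auto
  then show ?thesis
    unfolding tensor_apply_def by (intro sum.cong refl) simp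
qed

lemma tensor_apply_divide:
  assumes "finite I"
  shows "tensor_apply I T m (\<lambda>i. x i / r) js = tensor_apply I T m x js / r ^ m"
proof (induction m arbitrary: js)
  case (Suc m)
  then show ?case
    by (simp add: tensor_apply_Suc[OF assms] sum_divide_distrib)
qed simp

lemma tensor_apply_tendsto:
  assumes "finite I" "\<And>i. i \<in> I \<Longrightarrow> ((\<lambda>t. x t i) \<longlongrightarrow> y i) F"
  shows "((\<lambda>t. tensor_apply I T m (x t) js) \<longlongrightarrow> tensor_apply I T m y js) F"
proof (induction m arbitrary: js)
  case (Suc m)
  then show ?case
    unfolding tensor_apply_Suc[OF assms(1)] by (intro tendsto_sum tendsto_mult assms(2))
qed simp

lemma tensor_apply_bounded:
  assumes "finite I"
  shows "\<exists>C\<ge>0. \<forall>x. (\<forall>i\<in>I. \<bar>x i\<bar> \<le> B) \<longrightarrow> \<bar>tensor_apply I T m x js\<bar> \<le> C"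
proof (induction m arbitrary: js)
  case 0
  then show ?case by (auto intro!: exI[of _ "\<bar>T js\<bar>"])
next
  case (Suc m)
  then obtain C where C: "\<And>js. C js \<ge> 0"
    "\<And>js x. (\<forall>i\<in>I. \<bar>x i\<bar> \<le> B) \<Longrightarrow> \<bar>tensor_apply I T m x js\<bar> \<le> C js"
    by metis
  show ?case
  proof (intro exI conjI allI impI)
    show "0 \<le> (\<Sum>a\<in>I. \<bar>B\<bar> * C (js @ [a]))"
      by (intro sum_nonneg mult_nonneg_nonneg) (auto simp: C)
    fix x :: "nat \<Rightarrow> real"
    assume x: "\<forall>i\<in>I. \<bar>x i\<bar> \<le> B"
    show "\<bar>tensor_apply I T (Suc m) x js\<bar> \<le> (\<Sum>a\<in>I. \<bar>B\<bar> * C (js @ [a]))"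
      unfolding tensor_apply_Suc[OF assms]
    proof (rule order_trans[OF sum_abs sum_mono])
      fix a assume "a \<in> I"
      then show "\<bar>x a * tensor_apply I T m x (js @ [a])\<bar> \<le> \<bar>B\<bar> * C (js @ [a])"
        unfolding abs_mult using x C(2)[OF x, of "js @ [a]"] by (intro mult_mono) auto
    qed
  qed
qed

text \<open>Peeling off one index gives a product, hence two terms. By symmetry of \<open>T\<close>
  the differentiated index trades places with the peeled one, so the second term contracts to
  \<open>m\<close> copies of the first.\<close>

lemma tensor_apply_line_DERIV:
  assumes "finite I"
    and sym: "\<And>is js. \<lbrakk>mset is = mset js; length is = k\<rbrakk> \<Longrightarrow> T is = T js"
    and "length js + m = k"
  shows "((\<lambda>s. tensor_apply I T m (\<lambda>i. x i + s * d i) js) has_field_derivative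
           real m * (\<Sum>a\<in>I. d a * tensor_apply I T (m - 1) (\<lambda>i. x i + s * d i) (js @ [a]))) (at s)"
  using assms(3)
proof (induction m arbitrary: js)
  case 0
  then show ?case by simp
next
  case (Suc m)
  let ?y = "\<lambda>i. x i + s * d i"
  let ?A = "\<lambda>m. tensor_apply I T m ?y"
  have coord: "((\<lambda>s. x a + s * d a) has_field_derivative d a) (at s)" for a
    by (auto intro!: derivative_eq_intros)
  have "((\<lambda>s. tensor_apply I T (Suc m) (\<lambda>i. x i + s * d i) js) has_field_derivative
          (\<Sum>a\<in>I. d a * ?A m (js @ [a])
             + (real m * (\<Sum>b\<in>I. d b * ?A (m - 1) ((js @ [a]) @ [b]))) * ?y a)) (at s)"
    unfolding tensor_apply_Suc[OF assms(1)]
    by (intro DERIV_sum DERIV_mult coord Suc.IH) (use Suc.prems in auto)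
  also have "(\<Sum>a\<in>I. d a * ?A m (js @ [a])
             + (real m * (\<Sum>b\<in>I. d b * ?A (m - 1) ((js @ [a]) @ [b]))) * ?y a)
      = (\<Sum>a\<in>I. d a * ?A m (js @ [a]))
        + real m * (\<Sum>b\<in>I. d b * (\<Sum>a\<in>I. ?y a * ?A (m - 1) ((js @ [a]) @ [b])))"
  proof -
    have "(\<Sum>a\<in>I. (real m * (\<Sum>b\<in>I. d b * ?A (m - 1) ((js @ [a]) @ [b]))) * ?y a)
        = (\<Sum>a\<in>I. \<Sum>b\<in>I. real m * (d b * (?y a * ?A (m - 1) ((js @ [a]) @ [b]))))"
      unfolding sum_distrib_left sum_distrib_right by (intro sum.cong refl) (simp only: mult_ac)
    also have "\<dots> = real m * (\<Sum>b\<in>I. d b * (\<Sum>a\<in>I. ?y a * ?A (m - 1) ((js @ [a]) @ [b])))"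
      unfolding sum_distrib_left by (rule sum.swap)
    finally show ?thesis by (simp only: sum.distrib)
  qed
  also have "\<dots> = real (Suc m) * (\<Sum>a\<in>I. d a * ?A m (js @ [a]))"
  proof (cases m)
    case 0
    then show ?thesis by simp
  next
    case (Suc m')
    have "?A m' ((js @ [a]) @ [b]) = ?A m' ((js @ [b]) @ [a])" for a b
      by (rule tensor_apply_cong, rule sym) (use Suc.prems Suc in auto)
    then have "(\<Sum>a\<in>I. ?y a * ?A (m - 1) ((js @ [a]) @ [b])) = ?A m (js @ [b])" for b
      unfolding Suc tensor_apply_Suc[OF assms(1)] by simp
    then show ?thesis by (simp add: algebra_simps)
  qed
  finally show ?case by (simp only: diff_Suc_1)
qed

text \<open>For symmetric \<open>T\<close>, the \<open>r\<close>-th derivative of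
  \<open>tensor_apply I T m\<close> at \<open>y\<close> along \<open>d\<close>, as a recursion in
  which each order shows its factor from \<open>d\<close>.\<close>

fun dir_deriv ::
  "nat set \<Rightarrow> (nat list \<Rightarrow> real) \<Rightarrow> (nat \<Rightarrow> real) \<Rightarrow> nat \<Rightarrow> nat \<Rightarrow> nat list \<Rightarrow> (nat \<Rightarrow> real) \<Rightarrow> real"
where
  "dir_deriv I T d 0 m js y = tensor_apply I T m y js"
| "dir_deriv I T d (Suc r) m js y =
     real m * (\<Sum>a\<in>I. d a * dir_deriv I T d r (m - 1) (js @ [a]) y)"

lemma dir_deriv_DERIV:
  assumes "finite I"
    and sym: "\<And>is js. \<lbrakk>mset is = mset js; length is = k\<rbrakk> \<Longrightarrow> T is = T js"
    and "length js + m = k"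
  shows "((\<lambda>s. dir_deriv I T d r m js (\<lambda>i. x i + s * d i)) has_field_derivative
           dir_deriv I T d (Suc r) m js (\<lambda>i. x i + s * d i)) (at s)"
  using assms(3)
proof (induction r arbitrary: m js)
  case 0
  show ?case
    using tensor_apply_line_DERIV[OF assms(1) sym 0] by simp
next
  case (Suc r)
  show ?case
  proof (cases m)
    case 0
    then show ?thesis by simp
  next
    case (Suc m')
    then show ?thesis
      unfolding dir_deriv.simps(2)[of I T d _ m]
      using Suc.prems
      by (intro DERIV_cmult DERIV_sum Suc.IH) auto
  qed
qed

text \<open>Each order of differentiation contributes a factor of size at most
  \<open>\<Delta>\<close>. The constant is uniform in point and direction, as the Taylor remainder
  requires.\<close>

lemma dir_deriv_bounded:
  assumes "finite I"
  shows "\<exists>C\<ge>0. \<forall>x d \<Delta>. (\<forall>i\<in>I. \<bar>x i\<bar> \<le> B) \<longrightarrow> (\<forall>i\<in>I. \<bar>d i\<bar> \<le> \<Delta>) \<longrightarrow> 0 \<le> \<Delta> \<longrightarrow>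
           \<bar>dir_deriv I T d r m js x\<bar> \<le> C * \<Delta> ^ r"
proof (induction r arbitrary: m js)
  case 0
  then show ?case
    using tensor_apply_bounded[OF assms, of B T m js] by auto
next
  case (Suc r)
  then obtain C where C: "\<And>m js. C m js \<ge> 0"
    "\<And>m js x d \<Delta>. (\<forall>i\<in>I. \<bar>x i\<bar> \<le> B) \<Longrightarrow> (\<forall>i\<in>I. \<bar>d i\<bar> \<le> \<Delta>) \<Longrightarrow> 0 \<le> \<Delta> \<Longrightarrow>
           \<bar>dir_deriv I T d r m js x\<bar> \<le> C m js * \<Delta> ^ r"
    by metis
  show ?case
  proof (intro exI conjI allI impI)
    show "0 \<le> real m * (\<Sum>a\<in>I. C (m - 1) (js @ [a]))"
      by (intro sum_nonneg mult_nonneg_nonneg) (auto simp: C)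
    fix x d :: "nat \<Rightarrow> real" and \<Delta> :: real
    assume h: "\<forall>i\<in>I. \<bar>x i\<bar> \<le> B" "\<forall>i\<in>I. \<bar>d i\<bar> \<le> \<Delta>" "0 \<le> \<Delta>"
    have "\<bar>\<Sum>a\<in>I. d a * dir_deriv I T d r (m - 1) (js @ [a]) x\<bar>
        \<le> (\<Sum>a\<in>I. \<Delta> * (C (m - 1) (js @ [a]) * \<Delta> ^ r))"
      using h C(2)[OF h]
      by (intro order_trans[OF sum_abs sum_mono]) (simp add: abs_mult mult_mono)
    also have "\<dots> = (\<Sum>a\<in>I. C (m - 1) (js @ [a])) * \<Delta> ^ Suc r"
      by (simp add: sum_distrib_left sum_distrib_right mult_ac)
    finally show "\<bar>dir_deriv I T d (Suc r) m js x\<bar>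
        \<le> (real m * (\<Sum>a\<in>I. C (m - 1) (js @ [a]))) * \<Delta> ^ Suc r"
      by (simp add: abs_mult mult_left_mono mult.assoc)
  qed
qed

lemma tensor_apply_taylor:
  assumes "finite I" "k \<ge> 2"
    and sym: "\<And>is js. \<lbrakk>mset is = mset js; length is = k\<rbrakk> \<Longrightarrow> T is = T js"
  shows "\<exists>C\<ge>0. \<forall>x d \<Delta>. (\<forall>i\<in>I. \<bar>x i\<bar> \<le> 1) \<longrightarrow> (\<forall>i\<in>I. \<bar>d i\<bar> \<le> \<Delta>) \<longrightarrow> 0 \<le> \<Delta> \<longrightarrow> \<Delta> \<le> 1 \<longrightarrow>
     \<bar>tensor_apply I T k (\<lambda>i. x i + d i) [] - tensor_apply I T k x []
       - real k * (\<Sum>a\<in>I. d a * tensor_apply I T (k - 1) x [a])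
       - real k * (real k - 1) / 2 * (\<Sum>a\<in>I. \<Sum>b\<in>I. d a * tensor_apply I T (k - 2) x [a, b] * d b)\<bar>
     \<le> C * \<Delta> ^ 3"
proof -
  \<comment> \<open>The box of radius 2 contains every intermediate point \<open>x + s * d\<close>
    with \<open>0 < s < 1\<close>.\<close>
  obtain C where C: "C \<ge> 0" "\<And>x d \<Delta>. (\<forall>i\<in>I. \<bar>x i\<bar> \<le> 2) \<Longrightarrow> (\<forall>i\<in>I. \<bar>d i\<bar> \<le> \<Delta>) \<Longrightarrow> 0 \<le> \<Delta> \<Longrightarrow>
           \<bar>dir_deriv I T d 3 k [] x\<bar> \<le> C * \<Delta> ^ 3"
    using dir_deriv_bounded[OF assms(1), of 2 T 3 k "[]"] by metis
  show ?thesis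
  proof (intro exI[of _ C] conjI allI impI C(1))
    fix x d :: "nat \<Rightarrow> real" and \<Delta> :: real
    assume h: "\<forall>i\<in>I. \<bar>x i\<bar> \<le> 1" "\<forall>i\<in>I. \<bar>d i\<bar> \<le> \<Delta>" "0 \<le> \<Delta>" "\<Delta> \<le> 1"
    let ?D = "\<lambda>r s. dir_deriv I T d r k [] (\<lambda>i. x i + s * d i)"
    have "\<exists>s>0. s < 1 \<and> ?D 0 1 = (\<Sum>m<3. ?D m 0 / fact m * 1 ^ m) + ?D 3 s / fact 3 * 1 ^ 3"
      by (rule Maclaurin) (auto intro!: dir_deriv_DERIV[OF assms(1) sym] simp del: dir_deriv.simps)
    then obtain s where s: "0 < s" "s < 1"
      and eq: "?D 0 1 = (\<Sum>m<3. ?D m 0 / fact m) + ?D 3 s / 6"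
      by (auto simp: fact_numeral simp del: dir_deriv.simps)
    have "\<bar>x i + s * d i\<bar> \<le> 2" if "i \<in> I" for i
    proof -
      have "\<bar>s * d i\<bar> \<le> 1 * 1"
        unfolding abs_mult using s h(4) h(2)[rule_format, OF that] by (intro mult_mono) auto
      then show ?thesis using h(1)[rule_format, OF that] by linarith
    qed
    then have "\<bar>?D 3 s\<bar> \<le> C * \<Delta> ^ 3"
      by (intro C(2)) (use h in auto)
    then have b: "\<bar>?D 3 s / 6\<bar> \<le> C * \<Delta> ^ 3" by simp
    have sums: "(\<Sum>m<3. ?D m 0 / fact m) = ?D 0 0 + ?D 1 0 + ?D 2 0 / 2"
      by (simp add: numeral_3_eq_3 numeral_2_eq_2 del: dir_deriv.simps)
    have D0: "?D 0 1 = tensor_apply I T k (\<lambda>i. x i + d i) []" "?D 0 0 = tensor_apply I T k x []"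
      by simp_all
    have D1: "?D 1 0 = real k * (\<Sum>a\<in>I. d a * tensor_apply I T (k - 1) x [a])"
      by simp
    have D2: "?D 2 0 = real k * (real k - 1) *
        (\<Sum>a\<in>I. \<Sum>b\<in>I. d a * tensor_apply I T (k - 2) x [a, b] * d b)"
      using assms(2) by (simp add: numeral_2_eq_2 of_nat_diff sum_distrib_left mult_ac)
    show "\<bar>tensor_apply I T k (\<lambda>i. x i + d i) [] - tensor_apply I T k x []
       - real k * (\<Sum>a\<in>I. d a * tensor_apply I T (k - 1) x [a])
       - real k * (real k - 1) / 2 * (\<Sum>a\<in>I. \<Sum>b\<in>I. d a * tensor_apply I T (k - 2) x [a, b] * d b)\<bar>
     \<le> C * \<Delta> ^ 3"
      using b eq unfolding sums D0 D1 D2 by (simp add: algebra_simps)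
  qed
qed

text \<open>A power is the form of the constant tensor over a single index, which makes the
  expansion of powers an instance of the expansion of tensors.\<close>

lemma tensor_apply_singleton: "tensor_apply {i} (\<lambda>_. 1) m x js = x i ^ m"
  by (induction m arbitrary: js) (simp_all add: tensor_apply_Suc)

lemma power_taylor:
  assumes "k \<ge> 2"
  shows "\<exists>C\<ge>0. \<forall>a b \<Delta> :: real. \<bar>a\<bar> \<le> 1 \<longrightarrow> \<bar>b\<bar> \<le> \<Delta> \<longrightarrow> \<Delta> \<le> 1 \<longrightarrow>
     \<bar>(a + b) ^ k - a ^ k - real k * (a ^ (k - 1) * b)
        - real k * (real k - 1) / 2 * (a ^ (k - 2) * b\<^sup>2)\<bar> \<le> C * \<Delta> ^ 3"
proof -
  obtain C where "C \<ge> 0" and C: "\<And>x d \<Delta>. \<bar>x (0::nat)\<bar> \<le> 1 \<Longrightarrow> \<bar>d (0::nat)\<bar> \<le> \<Delta> \<Longrightarrow> 0 \<le> \<Delta> \<Longrightarrow> \<Delta> \<le> 1 \<Longrightarrow>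
     \<bar>(x 0 + d 0) ^ k - x 0 ^ k - real k * (d 0 * x 0 ^ (k - 1))
       - real k * (real k - 1) / 2 * (d 0 * x 0 ^ (k - 2) * d 0)\<bar> \<le> C * \<Delta> ^ 3"
    using tensor_apply_taylor[of "{0}" k "\<lambda>_. 1"] assms
    unfolding tensor_apply_singleton by auto
  show ?thesis
  proof (intro exI[of _ C] conjI allI impI \<open>C \<ge> 0\<close>)
    fix a b \<Delta> :: real
    assume "\<bar>a\<bar> \<le> 1" "\<bar>b\<bar> \<le> \<Delta>" "\<Delta> \<le> 1"
    then show "\<bar>(a + b) ^ k - a ^ k - real k * (a ^ (k - 1) * b)
        - real k * (real k - 1) / 2 * (a ^ (k - 2) * b\<^sup>2)\<bar> \<le> C * \<Delta> ^ 3"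
      using C[of "\<lambda>_. a" "\<lambda>_. b" \<Delta>] by (simp add: power2_eq_square mult_ac)
  qed
qed

section \<open>Z-matrices with a nonnegative null vector\<close>

text \<open>In terms of \<open>u = v / x\<close>, the pure squares in
  \<open>(u i - u l)\<^sup>2\<close>, weighted by \<open>W i l * x i * x l\<close>, sum to zero
  because \<open>W\<close> annihilates \<open>x\<close>. What remains is a sum of squares whose
  weights are nonnegative off the diagonal.\<close>

lemma quad_form_Z_matrix_nonneg:
  assumes sym: "\<And>i l. \<lbrakk>i \<in> I; l \<in> I\<rbrakk> \<Longrightarrow> W i l = W l i"
    and off: "\<And>i l. \<lbrakk>i \<in> I; l \<in> I; i \<noteq> l\<rbrakk> \<Longrightarrow> W i l \<le> 0"
    and ker: "\<And>i. i \<in> I \<Longrightarrow> (\<Sum>l\<in>I. W i l * x l) = 0"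
    and nonneg: "\<And>i. i \<in> I \<Longrightarrow> x i \<ge> 0"
    and supp: "\<And>i l. \<lbrakk>i \<in> I; l \<in> I; x i = 0\<rbrakk> \<Longrightarrow> W i l = 0"
  shows "quad_form I W v \<ge> 0"
proof -
  \<comment> \<open>Where \<open>x i = 0\<close>, division by zero gives \<open>u i = 0\<close>; the
    corresponding row and column of \<open>W\<close> vanish.\<close>
  define u where "u i = v i / x i" for i
  let ?P = "\<lambda>i l. W i l * x i * x l"
  have z1: "(\<Sum>i\<in>I. \<Sum>l\<in>I. ?P i l * (u i)\<^sup>2) = 0"
  proof (rule sum.neutral, rule ballI)
    fix i assume "i \<in> I"
    have "(\<Sum>l\<in>I. ?P i l * (u i)\<^sup>2) = x i * (u i)\<^sup>2 * (\<Sum>l\<in>I. W i l * x l)"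
      by (simp add: sum_distrib_left mult_ac)
    then show "(\<Sum>l\<in>I. ?P i l * (u i)\<^sup>2) = 0" using ker[OF \<open>i \<in> I\<close>] by simp
  qed
  have "(\<Sum>i\<in>I. \<Sum>l\<in>I. ?P i l * (u l)\<^sup>2) = (\<Sum>l\<in>I. \<Sum>i\<in>I. ?P i l * (u l)\<^sup>2)"
    by (rule sum.swap)
  also have "\<dots> = (\<Sum>i\<in>I. \<Sum>l\<in>I. ?P i l * (u i)\<^sup>2)"
  proof (intro sum.cong refl)
    fix l i assume "l \<in> I" "i \<in> I"
    then show "?P i l * (u l)\<^sup>2 = ?P l i * (u l)\<^sup>2"
      using sym[of i l] by simp
  qed
  finally have z2: "(\<Sum>i\<in>I. \<Sum>l\<in>I. ?P i l * (u l)\<^sup>2) = 0" using z1 by simp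
  have "quad_form I W v = (\<Sum>i\<in>I. \<Sum>l\<in>I. ?P i l * (u i * u l))"
    unfolding quad_form_def
  proof (intro sum.cong refl)
    fix i l assume il: "i \<in> I" "l \<in> I"
    show "v i * W i l * v l = ?P i l * (u i * u l)"
    proof (cases "x i = 0 \<or> x l = 0")
      case True
      then have "W i l = 0" using supp sym il by metis
      then show ?thesis by simp
    qed (simp add: u_def)
  qed
  also have "\<dots> = (\<Sum>i\<in>I. \<Sum>l\<in>I. - ?P i l * (u i - u l)\<^sup>2 / 2)"
  proof -
    have "(\<Sum>i\<in>I. \<Sum>l\<in>I. - ?P i l * (u i - u l)\<^sup>2 / 2)
        = (\<Sum>i\<in>I. \<Sum>l\<in>I. ?P i l * (u i * u l) - ?P i l * (u i)\<^sup>2 / 2 - ?P i l * (u l)\<^sup>2 / 2)"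
      by (intro sum.cong refl) (simp add: power2_eq_square field_simps)
    also have "\<dots> = (\<Sum>i\<in>I. \<Sum>l\<in>I. ?P i l * (u i * u l))
        - (\<Sum>i\<in>I. \<Sum>l\<in>I. ?P i l * (u i)\<^sup>2) / 2 - (\<Sum>i\<in>I. \<Sum>l\<in>I. ?P i l * (u l)\<^sup>2) / 2"
      by (simp add: sum_subtractf sum_divide_distrib)
    finally show ?thesis using z1 z2 by simp
  qed
  also have "\<dots> \<ge> 0"
  proof (intro sum_nonneg)
    fix i l assume il: "i \<in> I" "l \<in> I"
    show "- ?P i l * (u i - u l)\<^sup>2 / 2 \<ge> 0"
    proof (cases "i = l")
      case False
      then have "?P i l \<le> 0"
        using off nonneg il by (metis mult_nonpos_nonneg)
      then show ?thesis by (simp add: mult_nonpos_nonneg)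
    qed simp
  qed
  finally show ?thesis .
qed

section \<open>The Laplacian tensor and its quadratic model\<close>

locale laplacian =
  fixes k :: nat and E :: "nat set set" and I :: "nat set"
  assumes k_ge_3: "k \<ge> 3"
    and finite_I: "finite I"
    and card_edge: "\<And>e. e \<in> E \<Longrightarrow> card e = k"
begin

abbreviation "f \<equiv> lap_fun k E I"
abbreviation "c \<equiv> sphere_con k I"
abbreviation "A y i l \<equiv> tensor_apply I (laplacian_tensor k E) (k - 2) y [i, l]"
abbreviation "lam y \<equiv> multiplier I f y"
abbreviation "g y \<equiv> lag_grad f c (lam y) y"
abbreviation "W y \<equiv> lag_hess f c (lam y) y"
abbreviation "pred y d \<equiv> tr_model I f c y (\<lambda>_. 0) - tr_model I f c y d"

text \<open>The nonnegative part of the unit sphere of the \<open>k\<close>-norm; nonnegativity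
  allows the sum to be written without absolute values.\<close>

definition feas :: "(nat \<Rightarrow> real) \<Rightarrow> bool" where
  "feas y \<longleftrightarrow> (\<forall>i\<in>I. 0 \<le> y i) \<and> (\<Sum>i\<in>I. y i ^ k) = 1"

lemma k_pos: "k > 0" using k_ge_3 by simp

lemma laplacian_tensor_mset_cong:
  "\<lbrakk>mset is = mset js; length is = k\<rbrakk> \<Longrightarrow> laplacian_tensor k E is = laplacian_tensor k E js"
  using laplacian_tensor_sym k_pos by blast

lemma grad_f_eq:
  assumes "i \<in> I"
  shows "grad f y i = (\<Sum>l\<in>I. y l * A y i l)"
proof -
  have "k - 1 = Suc (k - 2)" using k_ge_3 by simp
  then show ?thesis
    using grad_lap_fun[OF finite_I assms k_pos] tensor_apply_Suc[OF finite_I] by simp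
qed

text \<open>Euler's identity for \<open>f\<close>, homogeneous of degree \<open>k\<close>.\<close>

lemma lam_eq: "lam y = real k * f y"
proof -
  have "k = Suc (k - 1)" using k_ge_3 by simp
  then have "tensor_apply I (laplacian_tensor k E) k y []
      = (\<Sum>a\<in>I. y a * tensor_apply I (laplacian_tensor k E) (k - 1) y [a])"
    using tensor_apply_Suc[OF finite_I, of "laplacian_tensor k E" "k - 1" y "[]"] by simp
  then show ?thesis
    using k_pos grad_lap_fun[OF finite_I _ k_pos]
    by (simp add: multiplier_def dotp_def lap_fun_def mult.commute)
qed

section \<open>Sign structure of the model Hessian\<close>

lemma A_sym: "A y i l = A y l i"
  by (rule tensor_apply_cong, rule laplacian_tensor_mset_cong) (use k_ge_3 in auto)

text \<open>Two distinct leading indices exclude the degree entries, so only the adjacency entries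
  remain, with a minus sign.\<close>

lemma A_off_diag:
  assumes "i \<noteq> l" "\<And>i. i \<in> I \<Longrightarrow> 0 \<le> y i"
  shows "A y i l \<le> 0"
  unfolding tensor_apply_def
proof (rule sum_nonpos)
  fix ms assume ms: "ms \<in> {is. set is \<subseteq> I \<and> length is = k - 2}"
  have "[i, l] @ ms \<noteq> replicate k (hd ([i, l] @ ms))"
  proof
    assume "[i, l] @ ms = replicate k (hd ([i, l] @ ms))"
    then have "set ([i, l] @ ms) \<subseteq> {i}" by (metis append_Cons list.sel(1) set_replicate_conv_if empty_subsetI order_refl)
    then show False using assms(1) by simp
  qed
  then have "laplacian_tensor k E ([i, l] @ ms) \<le> 0"
    unfolding laplacian_tensor_def by simp
  moreover have "prod_list (map y ms) \<ge> 0"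
    using ms assms(2) by (intro prod_list_nonneg) auto
  ultimately show "laplacian_tensor k E ([i, l] @ ms) * prod_list (map y ms) \<le> 0"
    by (rule mult_nonpos_nonneg)
qed

text \<open>An index list that starts with \<open>i\<close> twice has at most \<open>k - 1\<close>
  distinct entries, so it cannot run through an edge. Only the degree entry with all indices equal
  to \<open>i\<close> survives.\<close>

lemma A_diag:
  assumes "i \<in> I"
  shows "A y i i = real (degree E i) * y i ^ (k - 2)"
proof -
  let ?L = "{is. set is \<subseteq> I \<and> length is = k - 2}"
  have "laplacian_tensor k E ([i, i] @ ms) = (if ms = replicate (k - 2) i then real (degree E i) else 0)"
    if "ms \<in> ?L" for ms
  proof -
    have "card (set ([i, i] @ ms)) \<le> Suc (length ms)"
      by (metis append_Cons append_Nil card_length insert_absorb2 length_Cons list.simps(15))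
    then have "set ([i, i] @ ms) \<notin> E"
      using that k_ge_3 card_edge by fastforce
    moreover have "[i, i] @ ms = replicate k (hd ([i, i] @ ms)) \<longleftrightarrow> ms = replicate (k - 2) i"
    proof -
      have "k = Suc (Suc (k - 2))" using k_ge_3 by simp
      then have "replicate k i = [i, i] @ replicate (k - 2) i"
        by (metis append_Cons append_Nil replicate_Suc)
      then show ?thesis by simp
    qed
    ultimately show ?thesis unfolding laplacian_tensor_def by simp
  qed
  then have "A y i i = (\<Sum>ms\<in>?L. if ms = replicate (k - 2) i then real (degree E i) * prod_list (map y ms) else 0)"
    unfolding tensor_apply_def by (intro sum.cong) auto
  also have "\<dots> = real (degree E i) * prod_list (map y (replicate (k - 2) i))"
    using finite_lists_length_eq[OF finite_I, of "k - 2"] assms by (simp add: set_replicate_conv_if)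
  finally show ?thesis by (simp add: prod_list_replicate)
qed

lemma W_eq:
  assumes "i \<in> I" "l \<in> I"
  shows "W y i l = (real k - 1) * (A y i l - (if l = i then lam y * y i ^ (k - 2) else 0))"
  unfolding lag_hess_def hess_lap_fun[OF finite_I assms k_pos] hess_sphere_con[OF finite_I assms(1) k_pos]
  by (simp add: algebra_simps)

lemma W_sym:
  assumes "i \<in> I" "l \<in> I"
  shows "W y i l = W y l i"
  unfolding W_eq[OF assms] W_eq[OF assms(2,1)] using A_sym[of y i l] by simp

lemma W_off_diag:
  assumes "i \<in> I" "l \<in> I" "i \<noteq> l" "\<And>i. i \<in> I \<Longrightarrow> 0 \<le> y i"
  shows "W y i l \<le> 0"
  unfolding W_eq[OF assms(1,2)] using A_off_diag[OF assms(3), of y] assms(3,4) k_ge_3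
  by (simp add: mult_nonneg_nonpos)

lemma W_diag_zero:
  assumes "i \<in> I" "y i = 0"
  shows "W y i i = 0"
  unfolding W_eq[OF assms(1,1)] A_diag[OF assms(1)] using assms(2) k_ge_3 by simp

lemma g_eq:
  assumes "i \<in> I"
  shows "g y i = grad f y i - lam y * y i ^ (k - 1)"
  using grad_sphere_con[OF finite_I assms k_pos] by (simp add: lag_grad_def)

text \<open>Euler's identity for the gradients of \<open>f\<close> and \<open>c\<close>, which are homogeneous of degree \<open>k - 1\<close>.\<close>

lemma W_mult_self:
  assumes "i \<in> I"
  shows "(\<Sum>l\<in>I. W y i l * y l) = (real k - 1) * g y i"
proof -
  have p: "y i ^ (k - Suc 0) = y i ^ (k - 2) * y i"
    using k_ge_3 by (simp add: power_Suc2[symmetric] Suc_diff_le[symmetric] del: power_Suc)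
  have "(\<Sum>l\<in>I. W y i l * y l)
      = (\<Sum>l\<in>I. (real k - 1) * (y l * A y i l) - (if l = i then (real k - 1) * (lam y * y i ^ (k - 1)) else 0))"
    by (intro sum.cong refl) (auto simp: W_eq assms p algebra_simps)
  also have "\<dots> = (real k - 1) * (\<Sum>l\<in>I. y l * A y i l) - (real k - 1) * (lam y * y i ^ (k - 1))"
    unfolding sum_subtractf sum_distrib_left using finite_I assms by simp
  finally show ?thesis
    unfolding g_eq[OF assms] grad_f_eq[OF assms] by (simp add: right_diff_distrib)
qed

section \<open>Tangency, predicted decrease and projection\<close>

lemma dotp_grad_c: "dotp I (grad c y) v = (\<Sum>i\<in>I. y i ^ (k - 1) * v i)"
  unfolding dotp_def by (intro sum.cong) (simp_all add: grad_sphere_con[OF finite_I _ k_pos])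

lemma dotp_grad_c_self: "dotp I (grad c y) y = (\<Sum>i\<in>I. y i ^ k)"
  unfolding dotp_grad_c by (intro sum.cong refl power_minus_mult k_pos)

lemma dotp_g: "dotp I (g y) v = dotp I (grad f y) v - lam y * dotp I (grad c y) v"
  by (simp add: dotp_def lag_grad_def sum_subtractf sum_distrib_left algebra_simps)

lemma dotp_g_self:
  assumes "feas y"
  shows "dotp I (g y) y = 0"
  using assms unfolding dotp_g dotp_grad_c_self feas_def by (simp add: multiplier_def)

lemma pred_eq: "pred y d = - dotp I (g y) d - quad_form I (W y) d / 2"
  by (simp add: tr_model_def dotp_def quad_form_def)

lemma feas_le_1:
  assumes "feas y" "i \<in> I"
  shows "0 \<le> y i" "y i \<le> 1"
proof -
  show "0 \<le> y i" using assms by (simp add: feas_def)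
  have "y i ^ k \<le> (\<Sum>i\<in>I. y i ^ k)"
    using assms finite_I by (intro member_le_sum) (auto simp: feas_def)
  then show "y i \<le> 1"
    using assms k_pos by (metis feas_def one_less_power not_le)
qed

lemma f_cong: "(\<And>i. i \<in> I \<Longrightarrow> y i = z i) \<Longrightarrow> f y = f z"
  unfolding lap_fun_def using tensor_apply_cong_arg by metis

lemma kproj_eq:
  assumes "feas y" "tr_feasible I c y \<Delta> d"
  defines "N \<equiv> (\<Sum>i\<in>I. (y i + d i) ^ k)"
  shows "N > 0" "f (kproj k I (\<lambda>i. y i + d i)) = f (\<lambda>i. y i + d i) / N"
    "feas (kproj k I (\<lambda>i. y i + d i))"
proof -
  have nn: "0 \<le> y i + d i" if "i \<in> I" for i
    using assms(2) that by (simp add: tr_feasible_def)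
  have "N \<ge> 0" unfolding N_def using nn by (intro sum_nonneg zero_le_power)
  \<comment> \<open>If \<open>N\<close> were zero, \<open>d\<close> would be \<open>- y\<close> on
    \<open>I\<close>, and \<open>dotp I (grad c y) d\<close> would be \<open>- 1\<close> instead of
    0.\<close>
  moreover have "N \<noteq> 0"
  proof
    assume "N = 0"
    then have "\<forall>i\<in>I. (y i + d i) ^ k = 0"
      unfolding N_def using finite_I nn by (subst (asm) sum_nonneg_eq_0_iff) auto
    then have "d i = - y i" if "i \<in> I" for i using that by fastforce
    then have "dotp I (grad c y) d = - dotp I (grad c y) y"
      by (simp add: dotp_def sum_negf)
    then show False
      using assms(1,2) unfolding dotp_grad_c_self by (simp add: tr_feasible_def feas_def)
  qed
  ultimately show N: "N > 0" by simp
  have eq: "(\<Sum>i\<in>I. \<bar>y i + d i\<bar> ^ k) = N"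
    unfolding N_def using nn by (intro sum.cong) auto
  have pw: "knorm k I (\<lambda>i. y i + d i) ^ k = N"
    unfolding knorm_def eq using k_pos N by (simp add: real_root_pow_pos)
  have pos: "knorm k I (\<lambda>i. y i + d i) > 0"
    unfolding knorm_def eq using k_pos N by simp
  show "f (kproj k I (\<lambda>i. y i + d i)) = f (\<lambda>i. y i + d i) / N"
    unfolding lap_fun_def kproj_def tensor_apply_divide[OF finite_I] pw by simp
  show "feas (kproj k I (\<lambda>i. y i + d i))"
    unfolding feas_def kproj_def
    using pos nn N by (simp add: power_divide pw sum_divide_distrib[symmetric] N_def[symmetric])
qed

section \<open>Accuracy of the model\<close>

text \<open>With \<open>N\<close> the \<open>k\<close>-th power of the norm of \<open>y + d\<close>,
  the first expression compares \<open>N\<close> times the actual decrease with the prediction.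
  Tangency removes the linear term of \<open>N - 1\<close>; its quadratic term times
  \<open>f y\<close> is, by \<open>lam_eq\<close>, the constraint part of the model Hessian. Only
  cubic remainders are left. The bound on \<open>N\<close> controls the normalization.\<close>

lemma model_error:
  "\<exists>C\<ge>0. \<forall>y d \<Delta>. feas y \<longrightarrow> tr_feasible I c y \<Delta> d \<longrightarrow> 0 \<le> \<Delta> \<longrightarrow> \<Delta> \<le> 1 \<longrightarrow>
     \<bar>(\<Sum>i\<in>I. (y i + d i) ^ k) * f y - f (\<lambda>i. y i + d i) - pred y d\<bar> \<le> C * \<Delta> ^ 3 \<and>
     (\<Sum>i\<in>I. (y i + d i) ^ k) \<le> 1 + C * \<Delta>"
proof -
  have k2: "k \<ge> 2" using k_ge_3 by simp
  define h where "h = real k * (real k - 1) / 2"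
  have h: "h \<ge> 0" unfolding h_def using k_ge_3 by simp
  let ?L = "laplacian_tensor k E"
  let ?n = "real (card I)"
  obtain C1 where C1: "C1 \<ge> 0" "\<And>x d \<Delta>. \<lbrakk>\<forall>i\<in>I. \<bar>x i\<bar> \<le> 1; \<forall>i\<in>I. \<bar>d i\<bar> \<le> \<Delta>; 0 \<le> \<Delta>; \<Delta> \<le> 1\<rbrakk> \<Longrightarrow>
     \<bar>tensor_apply I ?L k (\<lambda>i. x i + d i) [] - tensor_apply I ?L k x []
       - real k * (\<Sum>a\<in>I. d a * tensor_apply I ?L (k - 1) x [a])
       - h * (\<Sum>a\<in>I. \<Sum>b\<in>I. d a * A x a b * d b)\<bar> \<le> C1 * \<Delta> ^ 3"
    using tensor_apply_taylor[where T = "laplacian_tensor k E", OF finite_I k2] laplacian_tensor_mset_cong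
    unfolding h_def by blast
  obtain C2 where C2: "C2 \<ge> 0" "\<And>a b \<Delta> :: real. \<lbrakk>\<bar>a\<bar> \<le> 1; \<bar>b\<bar> \<le> \<Delta>; \<Delta> \<le> 1\<rbrakk> \<Longrightarrow>
     \<bar>(a + b) ^ k - a ^ k - real k * (a ^ (k - 1) * b) - h * (a ^ (k - 2) * b\<^sup>2)\<bar> \<le> C2 * \<Delta> ^ 3"
    using power_taylor[OF k2] unfolding h_def by blast
  obtain M where M: "M \<ge> 0" "\<And>x. \<forall>i\<in>I. \<bar>x i\<bar> \<le> 1 \<Longrightarrow> \<bar>tensor_apply I ?L k x []\<bar> \<le> M"
    using tensor_apply_bounded[OF finite_I, of 1 ?L k "[]"] by metis
  \<comment> \<open>The first two summands bound the model error, the last two bound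
    \<open>N - 1\<close>.\<close>
  define C where "C = C1 + M * (?n * C2) + h * ?n + ?n * C2"
  show ?thesis
  proof (intro exI[of _ C] conjI allI impI)
    show "C \<ge> 0" unfolding C_def using C1(1) C2(1) M(1) h by simp
    fix y d :: "nat \<Rightarrow> real" and \<Delta> :: real
    assume y: "feas y" and d: "tr_feasible I c y \<Delta> d" and \<Delta>: "0 \<le> \<Delta>" "\<Delta> \<le> 1"
    define N where "N = (\<Sum>i\<in>I. (y i + d i) ^ k)"
    define Q where "Q = (\<Sum>i\<in>I. y i ^ (k - 2) * (d i)\<^sup>2)"
    have y1: "\<forall>i\<in>I. \<bar>y i\<bar> \<le> 1" using feas_le_1[OF y] by auto
    have d1: "\<forall>i\<in>I. \<bar>d i\<bar> \<le> \<Delta>" and tang: "dotp I (grad c y) d = 0"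
      using d by (auto simp: tr_feasible_def)
    have RN: "\<bar>N - 1 - h * Q\<bar> \<le> ?n * C2 * \<Delta> ^ 3"
    proof -
      have "N - 1 - h * Q = (\<Sum>i\<in>I. (y i + d i) ^ k - y i ^ k - real k * (y i ^ (k - 1) * d i)
          - h * (y i ^ (k - 2) * (d i)\<^sup>2))"
        using y tang unfolding N_def Q_def dotp_grad_c feas_def
        by (simp add: sum_subtractf sum_distrib_left[symmetric])
      also have "\<bar>\<dots>\<bar> \<le> (\<Sum>i\<in>I. C2 * \<Delta> ^ 3)"
        using y1 d1 \<Delta> by (intro order_trans[OF sum_abs sum_mono] C2(2)) auto
      finally show ?thesis by simp
    qed
    have Q: "Q \<le> ?n * \<Delta>"
    proof -
      have "Q \<le> (\<Sum>i\<in>I. \<Delta>)" unfolding Q_def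
      proof (rule sum_mono)
        fix i assume i: "i \<in> I"
        have "y i ^ (k - 2) * (d i)\<^sup>2 \<le> 1 * \<Delta>\<^sup>2"
          using feas_le_1[OF y i] d1 i by (intro mult_mono power_le_one abs_le_square_iff[THEN iffD1]) auto
        also have "1 * \<Delta>\<^sup>2 \<le> \<Delta>" using \<Delta> by (simp add: power2_eq_square mult_left_le)
        finally show "y i ^ (k - 2) * (d i)\<^sup>2 \<le> \<Delta>" .
      qed
      then show ?thesis by simp
    qed
    have \<Delta>3: "\<Delta> ^ 3 \<le> \<Delta>"
      using \<Delta> by (metis power_decreasing[of 1 3 \<Delta>] power_one_right one_le_numeral)
    define R where "R = f (\<lambda>i. y i + d i) - f y - dotp I (grad f y) d
        - (real k - 1) / 2 * (\<Sum>a\<in>I. \<Sum>b\<in>I. d a * A y a b * d b)"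
    have "\<bar>real k * R\<bar> \<le> C1 * \<Delta> ^ 3"
    proof -
      have fk: "real k * f z = tensor_apply I ?L k z []" for z
        using k_pos by (simp add: lap_fun_def)
      have df: "dotp I (grad f y) d = (\<Sum>a\<in>I. d a * tensor_apply I ?L (k - 1) y [a])"
        unfolding dotp_def by (intro sum.cong) (simp_all add: grad_lap_fun[OF finite_I _ k_pos])
      then show ?thesis
        using C1(2)[OF y1 d1 \<Delta>] unfolding R_def right_diff_distrib fk h_def df[symmetric] by (simp add: algebra_simps)
    qed
    moreover have "\<bar>R\<bar> \<le> \<bar>real k * R\<bar>"
      unfolding abs_mult using k_pos by (simp add: mult_le_cancel_right1)
    ultimately have R: "\<bar>R\<bar> \<le> C1 * \<Delta> ^ 3" by simp
    have dg: "dotp I (g y) d = dotp I (grad f y) d" by (simp add: dotp_g tang)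
    have qf: "quad_form I (W y) d = (real k - 1) * ((\<Sum>a\<in>I. \<Sum>b\<in>I. d a * A y a b * d b) - lam y * Q)"
    proof -
      have "quad_form I (W y) d = (\<Sum>a\<in>I. \<Sum>b\<in>I. (real k - 1) * (d a * A y a b * d b)
          - (if b = a then (real k - 1) * lam y * (y a ^ (k - 2) * (d a)\<^sup>2) else 0))"
        unfolding quad_form_def
        by (intro sum.cong refl) (auto simp: W_eq power2_eq_square algebra_simps)
      also have "\<dots> = (real k - 1) * (\<Sum>a\<in>I. \<Sum>b\<in>I. d a * A y a b * d b)
          - (real k - 1) * lam y * Q"
        unfolding Q_def sum_subtractf sum_distrib_left using finite_I by simp
      finally show ?thesis by (simp add: algebra_simps)
    qed
    have err: "N * f y - f (\<lambda>i. y i + d i) - pred y d = (N - 1 - h * Q) * f y - R"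
      unfolding pred_eq dg qf R_def h_def by (simp add: lam_eq field_simps)
    have fM: "\<bar>f y\<bar> \<le> M"
    proof -
      have "\<bar>f y\<bar> \<le> \<bar>tensor_apply I ?L k y []\<bar>"
        unfolding lap_fun_def using k_pos mult_right_mono[of 1 "real k" "\<bar>tensor_apply I ?L k y []\<bar>"]
        by (simp add: field_simps)
      then show ?thesis using M(2)[OF y1] by simp
    qed
    have "\<bar>(N - 1 - h * Q) * f y\<bar> \<le> (?n * C2 * \<Delta> ^ 3) * M"
      unfolding abs_mult using RN fM by (intro mult_mono) auto
    then have "\<bar>N * f y - f (\<lambda>i. y i + d i) - pred y d\<bar> \<le> (?n * C2 * \<Delta> ^ 3) * M + C1 * \<Delta> ^ 3"
      unfolding err using R by linarith
    also have "\<dots> = (C1 + M * (?n * C2)) * \<Delta> ^ 3" by (simp add: algebra_simps)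
    also have "\<dots> \<le> C * \<Delta> ^ 3"
      unfolding C_def using C2(1) h \<Delta> by (intro mult_right_mono) auto
    finally show "\<bar>(\<Sum>i\<in>I. (y i + d i) ^ k) * f y - f (\<lambda>i. y i + d i) - pred y d\<bar> \<le> C * \<Delta> ^ 3"
      unfolding N_def .
    have "N \<le> 1 + h * (?n * \<Delta>) + ?n * C2 * \<Delta>"
    proof -
      have "h * Q \<le> h * (?n * \<Delta>)" using Q h by (rule mult_left_mono)
      moreover have "?n * C2 * \<Delta> ^ 3 \<le> ?n * C2 * \<Delta>"
        using \<Delta>3 C2(1) by (intro mult_left_mono) auto
      ultimately show ?thesis using RN by linarith
    qed
    also have "\<dots> \<le> 1 + C * \<Delta>"
      unfolding C_def using C1(1) C2(1) M(1) \<Delta> by (simp add: algebra_simps)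
    finally show "(\<Sum>i\<in>I. (y i + d i) ^ k) \<le> 1 + C * \<Delta>" unfolding N_def .
  qed
qed

text \<open>The model error is cubic in the radius and the predicted decrease is at least quadratic,
  so the ratio tends to at least 1 uniformly as the radius shrinks.\<close>

lemma ratio_large:
  assumes "\<kappa> > 0" "0 < \<sigma>" "\<sigma> < 1"
  shows "\<exists>\<delta>>0. \<forall>y d \<Delta>. feas y \<longrightarrow> tr_feasible I c y \<Delta> d \<longrightarrow> 0 < \<Delta> \<longrightarrow> \<Delta> \<le> \<delta> \<longrightarrow>
     pred y d \<ge> \<kappa> * \<Delta>\<^sup>2 \<longrightarrow> tr_ratio k I f c y d > \<sigma>"
proof -
  obtain C where C: "C \<ge> 0" "\<And>y d \<Delta>. \<lbrakk>feas y; tr_feasible I c y \<Delta> d; 0 \<le> \<Delta>; \<Delta> \<le> 1\<rbrakk> \<Longrightarrow>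
     \<bar>(\<Sum>i\<in>I. (y i + d i) ^ k) * f y - f (\<lambda>i. y i + d i) - pred y d\<bar> \<le> C * \<Delta> ^ 3 \<and>
     (\<Sum>i\<in>I. (y i + d i) ^ k) \<le> 1 + C * \<Delta>"
    using model_error by blast
  \<comment> \<open>\<open>C / \<kappa>\<close> accounts for the relative model error and
    \<open>C\<close> for the normalization; the 1 makes \<open>K\<close> positive and the final
    inequality strict.\<close>
  define K where "K = C / \<kappa> + C + 1"
  have K: "K > 0" unfolding K_def using C(1) assms(1) by (simp add: add_nonneg_pos)
  define \<delta> where "\<delta> = min 1 ((1 - \<sigma>) / K)"
  show ?thesis
  proof (intro exI[of _ \<delta>] conjI allI impI)
    show "\<delta> > 0" unfolding \<delta>_def using K assms by simp
    fix y d \<Delta>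
    assume y: "feas y" and d: "tr_feasible I c y \<Delta> d" and \<Delta>: "0 < \<Delta>" "\<Delta> \<le> \<delta>"
      and p: "pred y d \<ge> \<kappa> * \<Delta>\<^sup>2"
    have \<Delta>1: "\<Delta> \<le> 1" and "\<Delta> \<le> (1 - \<sigma>) / K" using \<Delta>(2) unfolding \<delta>_def by auto
    then have \<Delta>K: "K * \<Delta> \<le> 1 - \<sigma>" using K by (simp add: field_simps)
    let ?N = "\<Sum>i\<in>I. (y i + d i) ^ k"
    let ?p = "pred y d"
    have N: "?N > 0" by (rule kproj_eq(1)[OF y d])
    have e: "\<bar>?N * f y - f (\<lambda>i. y i + d i) - ?p\<bar> \<le> C * \<Delta> ^ 3" "?N \<le> 1 + C * \<Delta>"
      using C(2)[OF y d] \<Delta> \<Delta>1 by auto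
    have ppos: "?p > 0" using p assms(1) \<Delta>(1) by (smt (verit) mult_pos_pos zero_less_power)
    have "C * \<Delta> ^ 3 = C / \<kappa> * \<Delta> * (\<kappa> * \<Delta>\<^sup>2)"
      using assms(1) by (simp add: power2_eq_square power3_eq_cube)
    also have "\<dots> \<le> C / \<kappa> * \<Delta> * ?p"
      using p C(1) assms(1) \<Delta>(1) by (intro mult_left_mono) auto
    finally have "?N * f y - f (\<lambda>i. y i + d i) \<ge> (1 - C / \<kappa> * \<Delta>) * ?p"
      using e(1) by (simp add: algebra_simps)
    moreover have "\<sigma> * ?N < 1 - C / \<kappa> * \<Delta>"
    proof -
      have "\<sigma> * ?N \<le> \<sigma> * (1 + C * \<Delta>)" using e(2) assms(2) by (intro mult_left_mono) auto
      also have "\<dots> \<le> \<sigma> + C * \<Delta>"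
        using assms(2,3) C(1) \<Delta>(1) by (simp add: distrib_left mult_left_le_one_le)
      finally show ?thesis using \<Delta>K \<Delta>(1) unfolding K_def by (simp add: algebra_simps)
    qed
    ultimately have "\<sigma> * ?N * ?p < ?N * f y - f (\<lambda>i. y i + d i)"
      using ppos by (smt (verit) mult_strict_right_mono)
    \<comment> \<open>Numerator and denominator are multiplied by the positive \<open>N\<close> to
      reach the form of \<open>model_error\<close>.\<close>
    moreover have "tr_ratio k I f c y d = (?N * f y - f (\<lambda>i. y i + d i)) / (?N * ?p)"
      unfolding tr_ratio_def kproj_eq(2)[OF y d] using N by (simp add: field_simps)
    ultimately show "tr_ratio k I f c y d > \<sigma>"
      using N ppos by (simp add: pos_less_divide_eq mult.assoc)
  qed
qed

section \<open>Continuity of the model data\<close>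

lemma f_tendsto:
  assumes "\<And>i. i \<in> I \<Longrightarrow> ((\<lambda>t. x t i) \<longlongrightarrow> y i) F"
  shows "((\<lambda>t. f (x t)) \<longlongrightarrow> f y) F"
  unfolding lap_fun_def by (intro tendsto_mult tendsto_const tensor_apply_tendsto[OF finite_I] assms)

lemma g_tendsto:
  assumes "\<And>i. i \<in> I \<Longrightarrow> ((\<lambda>t. x t i) \<longlongrightarrow> y i) F" "i \<in> I"
  shows "((\<lambda>t. g (x t) i) \<longlongrightarrow> g y i) F"
  unfolding g_eq[OF assms(2)] grad_lap_fun[OF finite_I assms(2) k_pos]
  unfolding lam_eq
  by (intro tendsto_intros tensor_apply_tendsto[OF finite_I] f_tendsto assms)

lemma W_tendsto:
  assumes "\<And>i. i \<in> I \<Longrightarrow> ((\<lambda>t. x t i) \<longlongrightarrow> y i) F" "i \<in> I" "l \<in> I"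
  shows "((\<lambda>t. W (x t) i l) \<longlongrightarrow> W y i l) F"
proof -
  have "((\<lambda>t. if l = i then real k * f (x t) * x t i ^ (k - 2) else 0) \<longlongrightarrow>
      (if l = i then real k * f y * y i ^ (k - 2) else 0)) F"
    by (cases "l = i") (auto intro!: tendsto_intros f_tendsto assms)
  then show ?thesis
    unfolding W_eq[OF assms(2,3)]
    unfolding lam_eq
    by (intro tendsto_mult tendsto_diff tendsto_const tensor_apply_tendsto[OF finite_I] assms)
qed

lemma dotp_grad_c_tendsto:
  assumes "\<And>i. i \<in> I \<Longrightarrow> ((\<lambda>t. x t i) \<longlongrightarrow> y i) F"
  shows "((\<lambda>t. dotp I (grad c (x t)) v) \<longlongrightarrow> dotp I (grad c y) v) F"
  unfolding dotp_grad_c by (intro tendsto_intros assms)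

end

section \<open>Convergent runs\<close>

locale ftr = laplacian +
  fixes \<sigma>0 \<sigma>1 \<sigma>2 \<Delta>max \<epsilon> :: real
    and x d :: "nat \<Rightarrow> nat \<Rightarrow> real" and \<Delta> :: "nat \<Rightarrow> real" and xs :: "nat \<Rightarrow> real"
  assumes \<sigma>0_pos: "0 < \<sigma>0" and \<sigma>0_less: "\<sigma>0 < \<sigma>1" and \<sigma>1_less: "\<sigma>1 < 1"
    and run: "ftr_run k I f c \<sigma>0 \<sigma>1 \<sigma>2 \<Delta>max \<epsilon> x d \<Delta>"
    and lim: "\<And>i. i \<in> I \<Longrightarrow> (\<lambda>t. x t i) \<longlonglongrightarrow> xs i"
begin

abbreviation "\<rho> t \<equiv> tr_ratio k I f c (x t) (d t)"

section \<open>Invariants of the run\<close>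

lemma step_minimizer: "tr_minimizer I f c (x t) (\<Delta> t) (d t)"
  using run unfolding ftr_run_def by blast

lemma step_feasible: "tr_feasible I c (x t) (\<Delta> t) (d t)"
  using step_minimizer unfolding tr_minimizer_def by blast

lemma pred_ge: "tr_feasible I c (x t) (\<Delta> t) d' \<Longrightarrow> pred (x t) (d t) \<ge> pred (x t) d'"
  using step_minimizer[of t] unfolding tr_minimizer_def by simp

lemma radius_step:
  "\<Delta> (Suc t) = (if \<rho> t \<le> \<sigma>1 then 1 / 2 * \<Delta> t
     else if \<rho> t > \<sigma>2 then min \<Delta>max (2 * \<Delta> t) else \<Delta> t)"
  using run unfolding ftr_run_def Let_def by blast

lemma iterate_step:
  "i \<in> I \<Longrightarrow> x (Suc t) i = (if \<rho> t \<ge> \<sigma>0 then kproj k I (\<lambda>l. x t l + d t l) i else x t i)"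
  using run unfolding ftr_run_def Let_def by blast

lemma radius_bounds: "0 < \<Delta> t \<and> \<Delta> t \<le> \<Delta>max"
proof (induction t)
  case 0
  then show ?case using run by (simp add: ftr_run_def)
next
  case (Suc t)
  then show ?case using radius_step[of t] by auto
qed

lemma feas_cong: "(\<And>i. i \<in> I \<Longrightarrow> y i = z i) \<Longrightarrow> feas y = feas z"
  unfolding feas_def by (simp cong: sum.cong)

lemma feas_iterate: "feas (x t)"
proof (induction t)
  case 0
  have nn: "\<forall>i\<in>I. 0 \<le> x 0 i" and "knorm k I (x 0) = 1"
    using run by (auto simp: ftr_run_def)
  then have "(\<Sum>i\<in>I. \<bar>x 0 i\<bar> ^ k) = 1"
    unfolding knorm_def using k_pos by simp
  then show ?case using nn unfolding feas_def by (simp cong: sum.cong)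
next
  case (Suc t)
  show ?case
  proof (cases "\<rho> t \<ge> \<sigma>0")
    case True
    then have "feas (x (Suc t)) = feas (kproj k I (\<lambda>l. x t l + d t l))"
      using iterate_step by (intro feas_cong) simp
    then show ?thesis using kproj_eq(3)[OF Suc step_feasible] by simp
  next
    case False
    then have "feas (x (Suc t)) = feas (x t)"
      using iterate_step by (intro feas_cong) simp
    then show ?thesis using Suc by simp
  qed
qed

lemma feas_limit: "feas xs"
proof -
  have "0 \<le> xs i" if "i \<in> I" for i
    using lim[OF that] feas_iterate that
    by (intro LIMSEQ_le_const[OF lim[OF that]]) (auto simp: feas_def)
  moreover have "(\<lambda>t. \<Sum>i\<in>I. x t i ^ k) \<longlonglongrightarrow> (\<Sum>i\<in>I. xs i ^ k)"
    by (intro tendsto_intros lim)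
  then have "(\<Sum>i\<in>I. xs i ^ k) = 1"
    using feas_iterate LIMSEQ_unique[OF _ tendsto_const] unfolding feas_def by auto
  ultimately show ?thesis unfolding feas_def by blast
qed

text \<open>Positivity of the prediction lets the quotient defining the ratio be multiplied out,
  away from the default value of division by zero.\<close>

lemma actual_decrease:
  assumes "\<rho> t \<ge> \<sigma>0" "pred (x t) (d t) > 0"
  shows "f (x t) - f (x (Suc t)) = \<rho> t * pred (x t) (d t)"
proof -
  have "f (x (Suc t)) = f (kproj k I (\<lambda>l. x t l + d t l))"
    using iterate_step assms(1) by (intro f_cong) simp
  then show ?thesis using assms(2) unfolding tr_ratio_def by simp
qed

text \<open>
  A uniform quadratic decrease of the model would keep the radius away from \<open>0\<close>, because short
  steps are then successful; but each of the successful steps would decrease \<open>f\<close> by a fixed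
  amount, so that from some index on all steps are rejected and the radius tends to \<open>0\<close>.
\<close>

lemma no_uniform_decrease:
  assumes "\<kappa> > 0" "s0 > 0"
    and ev: "\<forall>\<^sub>F t in sequentially. \<forall>s. 0 \<le> s \<longrightarrow> s \<le> s0 \<longrightarrow> s \<le> \<Delta> t \<longrightarrow> pred (x t) (d t) \<ge> \<kappa> * s\<^sup>2"
  shows False
proof -
  obtain \<delta> where \<delta>: "\<delta> > 0" "\<And>y d \<Delta>. \<lbrakk>feas y; tr_feasible I c y \<Delta> d; 0 < \<Delta>; \<Delta> \<le> \<delta>;
      pred y d \<ge> \<kappa> * \<Delta>\<^sup>2\<rbrakk> \<Longrightarrow> tr_ratio k I f c y d > \<sigma>1"
    using ratio_large[OF assms(1) _ \<sigma>1_less] \<sigma>0_pos \<sigma>0_less by (meson order.strict_trans)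
  obtain T where T: "\<And>t s. \<lbrakk>t \<ge> T; 0 \<le> s; s \<le> s0; s \<le> \<Delta> t\<rbrakk> \<Longrightarrow> pred (x t) (d t) \<ge> \<kappa> * s\<^sup>2"
    using ev unfolding eventually_sequentially by blast
  define \<delta>1 where "\<delta>1 = min \<delta> s0"
  \<comment> \<open>Up to \<open>\<delta>1\<close> the radius does not shrink, and above
    \<open>\<delta>1\<close> it is at most halved. From \<open>T\<close> on it therefore never falls
    below this value.\<close>
  define b where "b = min (\<Delta> T) (\<delta>1 / 2)"
  have b: "b > 0" unfolding b_def \<delta>1_def using radius_bounds \<delta>(1) assms(2) by simp
  have \<Delta>b: "\<Delta> t \<ge> b" if "t \<ge> T" for t
    using that
  proof (induction t rule: dec_induct)
    case base
    then show ?case by (simp add: b_def)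
  next
    case (step t)
    note bd = radius_bounds[of t]
    show ?case
    proof (cases "\<Delta> t \<le> \<delta>1")
      case True
      then have le: "\<Delta> t \<le> \<delta>" "\<Delta> t \<le> s0" unfolding \<delta>1_def by simp_all
      then have "pred (x t) (d t) \<ge> \<kappa> * (\<Delta> t)\<^sup>2"
        using T[OF step.hyps(1), of "\<Delta> t"] bd by simp
      then have "\<rho> t > \<sigma>1"
        using \<delta>(2)[OF feas_iterate step_feasible] bd le by blast
      \<comment> \<open>The cap \<open>\<Delta>max\<close> cannot lower the radius, since
        \<open>\<Delta> t \<le> \<Delta>max\<close>.\<close>
      then have "\<Delta> (Suc t) \<ge> \<Delta> t"
        using radius_step[of t] bd by auto
      then show ?thesis using step.IH by simp
    next
      case False
      moreover have "\<Delta> (Suc t) \<ge> \<Delta> t / 2" using radius_step[of t] bd by auto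
      ultimately show ?thesis unfolding b_def by linarith
    qed
  qed
  define p where "p = \<kappa> * (min s0 b)\<^sup>2"
  have p: "p > 0" unfolding p_def using assms b by simp
  have pp: "pred (x t) (d t) \<ge> p" if "t \<ge> T" for t
    unfolding p_def using T[OF that, of "min s0 b"] \<Delta>b[OF that] assms(2) b by simp
  have fx: "(\<lambda>t. f (x t)) \<longlonglongrightarrow> f xs"
    by (rule f_tendsto) (rule lim)
  have "(\<lambda>t. f (x t) - f (x (Suc t))) \<longlonglongrightarrow> f xs - f xs"
    by (rule tendsto_diff[OF fx LIMSEQ_Suc[OF fx]])
  then have "\<forall>\<^sub>F t in sequentially. f (x t) - f (x (Suc t)) < \<sigma>0 * p"
    by (rule order_tendstoD(2)) (simp add: mult_pos_pos[OF \<sigma>0_pos p])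
  then obtain T2 where T2: "\<And>t. t \<ge> T2 \<Longrightarrow> f (x t) - f (x (Suc t)) < \<sigma>0 * p"
    unfolding eventually_sequentially by blast
  define T3 where "T3 = max T T2"
  have half: "\<Delta> (Suc t) = \<Delta> t / 2" if t: "t \<ge> T3" for t
  proof -
    \<comment> \<open>An accepted step would decrease \<open>f\<close> by at least
      \<open>\<sigma>0 * p\<close>, while the decreases of the convergent sequence
      \<open>f (x t)\<close> tend to zero.\<close>
    have "\<rho> t < \<sigma>0"
    proof (rule ccontr)
      assume "\<not> \<rho> t < \<sigma>0"
      then have \<rho>: "\<rho> t \<ge> \<sigma>0" by simp
      have pt: "pred (x t) (d t) \<ge> p" using pp t unfolding T3_def by simp
      have "\<sigma>0 * p \<le> \<rho> t * pred (x t) (d t)"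
        using \<rho> pt p \<sigma>0_pos by (intro mult_mono) auto
      also have "\<dots> = f (x t) - f (x (Suc t))"
        using actual_decrease[OF \<rho>] pt p by simp
      finally show False using T2[of t] t unfolding T3_def by simp
    qed
    then show ?thesis using radius_step[of t] \<sigma>0_less by simp
  qed
  have pw: "\<Delta> (T3 + m) = \<Delta> T3 * (1 / 2) ^ m" for m
    by (induction m) (simp_all add: half)
  have "(\<lambda>m. \<Delta> T3 * (1 / 2 :: real) ^ m) \<longlonglongrightarrow> \<Delta> T3 * 0"
    by (intro tendsto_mult tendsto_const LIMSEQ_power_zero) simp
  then have "\<forall>\<^sub>F m in sequentially. \<Delta> T3 * (1 / 2) ^ m < b"
    using b by (intro order_tendstoD(2)) simp_all
  then obtain m where "\<Delta> (T3 + m) < b"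
    unfolding pw eventually_sequentially by blast
  moreover have "T \<le> T3 + m" unfolding T3_def by simp
  ultimately show False using \<Delta>b[of "T3 + m"] by simp
qed

text \<open>
  Since \<open>\<nabla>c(x\<^sub>t)\<^sup>T x\<^sub>t = 1\<close>, subtracting a multiple of \<open>x\<^sub>t\<close> makes a direction tangential. This
  preserves \<open>x\<^sub>t + d \<ge> 0\<close> for short steps and does not change the linear term, as \<open>g\<^sub>t\<^sup>T x\<^sub>t = 0\<close>.
\<close>

definition tang :: "(nat \<Rightarrow> real) \<Rightarrow> (nat \<Rightarrow> real) \<Rightarrow> nat \<Rightarrow> real" where
  "tang y v = (\<lambda>i. v i - dotp I (grad c y) v * y i)"

text \<open>The step \<open>s * tang (x t) v\<close> competes in the subproblem for every
  \<open>s \<le> \<Delta> t\<close> up to \<open>s0\<close>, so the minimizer predicts at least the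
  decrease it achieves, contradicting \<open>no_uniform_decrease\<close>. The bound on
  \<open>v\<close> keeps the entries of \<open>tang (x t) v\<close> at most 1 in absolute
  value.\<close>

lemma no_uniform_descent_direction:
  assumes v: "(\<Sum>i\<in>I. \<bar>v i\<bar>) \<le> 1 / 2"
    and s0: "0 < s0" "s0 \<le> 1"
    and pos: "\<And>i. i \<in> I \<Longrightarrow> 0 \<le> v i \<or> s0 < xs i"
    and "\<kappa> > 0"
    and ev: "\<forall>\<^sub>F t in sequentially. \<forall>s. 0 \<le> s \<longrightarrow> s \<le> s0 \<longrightarrow>
       s * dotp I (g (x t)) v + s\<^sup>2 * quad_form I (W (x t)) (tang (x t) v) / 2 \<le> - \<kappa> * s\<^sup>2"
  shows False
proof -
  have "\<forall>\<^sub>F t in sequentially. 0 \<le> v i \<or> s0 < x t i" if "i \<in> I" for i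
    using pos[OF that] order_tendstoD(1)[OF lim[OF that]]
    by (auto elim: eventually_mono)
  then have "\<forall>\<^sub>F t in sequentially. \<forall>i\<in>I. 0 \<le> v i \<or> s0 < x t i"
    using finite_I by (simp add: eventually_ball_finite)
  then have "\<forall>\<^sub>F t in sequentially. \<forall>s. 0 \<le> s \<longrightarrow> s \<le> s0 \<longrightarrow> s \<le> \<Delta> t \<longrightarrow> pred (x t) (d t) \<ge> \<kappa> * s\<^sup>2"
    using ev
  proof eventually_elim
    case (elim t)
    show ?case
    proof (intro allI impI)
      fix s assume s: "0 \<le> s" "s \<le> s0" "s \<le> \<Delta> t"
      define \<eta> where "\<eta> = dotp I (grad c (x t)) v"
      let ?d = "\<lambda>i. s * tang (x t) v i"
      have x01: "0 \<le> x t i" "x t i \<le> 1" if "i \<in> I" for i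
        using feas_le_1[OF feas_iterate that] .
      have "\<bar>\<eta>\<bar> \<le> (\<Sum>i\<in>I. \<bar>v i\<bar>)"
        unfolding \<eta>_def dotp_grad_c
      proof (rule order_trans[OF sum_abs sum_mono])
        fix i assume i: "i \<in> I"
        show "\<bar>x t i ^ (k - 1) * v i\<bar> \<le> \<bar>v i\<bar>"
          unfolding abs_mult using x01[OF i] by (intro mult_left_le_one_le) (simp_all add: power_le_one)
      qed
      then have \<eta>: "\<bar>\<eta>\<bar> \<le> 1 / 2" using v by simp
      have vi: "\<bar>v i\<bar> \<le> 1 / 2" if "i \<in> I" for i
        using member_le_sum[OF that, of "\<lambda>i. \<bar>v i\<bar>"] finite_I v by simp
      have td: "tang (x t) v i = v i - \<eta> * x t i" for i
        unfolding tang_def \<eta>_def ..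
      have \<eta>x: "\<bar>\<eta> * x t i\<bar> \<le> 1 / 2 * x t i" if "i \<in> I" for i
        unfolding abs_mult using mult_right_mono[OF \<eta> x01(1)[OF that]] x01[OF that] by simp
      have "tr_feasible I c (x t) (\<Delta> t) ?d"
        unfolding tr_feasible_def
      proof (intro conjI ballI)
        have "dotp I (grad c (x t)) ?d = s * (dotp I (grad c (x t)) v - \<eta> * dotp I (grad c (x t)) (x t))"
          unfolding td dotp_def sum_distrib_left sum_subtractf[symmetric]
          by (intro sum.cong) (auto simp: algebra_simps)
        then show "dotp I (grad c (x t)) ?d = 0"
          using feas_iterate[of t] unfolding dotp_grad_c_self \<eta>_def feas_def by simp
        fix i assume i: "i \<in> I"
        have "\<bar>tang (x t) v i\<bar> \<le> 1"
          using vi[OF i] \<eta>x[OF i] x01[OF i] unfolding td by linarith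
        then have "\<bar>?d i\<bar> \<le> s * 1"
          unfolding abs_mult using s(1) by (intro mult_mono) auto
        then show "\<bar>?d i\<bar> \<le> \<Delta> t" using s(3) by simp
        \<comment> \<open>The shift along \<open>x t\<close> uses up at most half of
          \<open>x t i\<close>; a negative \<open>s * v i\<close> uses up at most
          \<open>s0 / 2\<close>, which is less than the other half.\<close>
        have "\<bar>s * (\<eta> * x t i)\<bar> \<le> 1 * (1 / 2 * x t i)"
          unfolding abs_mult[of s] using s s0 \<eta>x[OF i] by (intro mult_mono) auto
        moreover have "s * v i \<ge> 0 \<or> (s * v i \<ge> - (s0 / 2) \<and> s0 < x t i)"
        proof (cases "0 \<le> v i")
          case True
          then show ?thesis using s(1) by simp
        next
          case False
          have "\<bar>s * v i\<bar> \<le> s0 * (1 / 2)"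
            unfolding abs_mult using s vi[OF i] by (intro mult_mono) auto
          then show ?thesis using False elim(1) i by auto
        qed
        ultimately show "0 \<le> x t i + ?d i"
          using x01(1)[OF i] unfolding td by (auto simp: right_diff_distrib)
      qed
      then have "pred (x t) ?d \<le> pred (x t) (d t)" by (rule pred_ge)
      moreover have "dotp I (g (x t)) ?d = s * dotp I (g (x t)) v"
      proof -
        have "dotp I (g (x t)) ?d = s * (dotp I (g (x t)) v - \<eta> * dotp I (g (x t)) (x t))"
          unfolding td dotp_def sum_distrib_left sum_subtractf[symmetric]
          by (intro sum.cong) (auto simp: algebra_simps)
        then show ?thesis using dotp_g_self[OF feas_iterate] by simp
      qed
      moreover have "quad_form I (W (x t)) ?d = s\<^sup>2 * quad_form I (W (x t)) (tang (x t) v)"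
        unfolding quad_form_def sum_distrib_left
        by (intro sum.cong) (auto simp: power2_eq_square)
      ultimately show "\<kappa> * s\<^sup>2 \<le> pred (x t) (d t)"
        using elim(2) s unfolding pred_eq by fastforce
    qed
  qed
  then show False using no_uniform_decrease[OF \<open>\<kappa> > 0\<close> s0(1)] by blast
qed

section \<open>Descent directions at the limit\<close>

lemma quad_form_tang_tendsto:
  "(\<lambda>t. quad_form I (W (x t)) (tang (x t) v)) \<longlonglongrightarrow> quad_form I (W xs) (tang xs v)"
  unfolding quad_form_def tang_def
  by (intro tendsto_sum tendsto_mult tendsto_diff tendsto_const W_tendsto dotp_grad_c_tendsto lim)

text \<open>For short \<open>s\<close> a negative slope dominates the bounded quadratic term, which
  would give a uniform decrease of at least \<open>s\<^sup>2\<close>.\<close>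

lemma no_first_order_descent:
  assumes v: "(\<Sum>i\<in>I. \<bar>v i\<bar>) \<le> 1 / 2"
    and s0: "0 < s0" "s0 \<le> 1"
    and pos: "\<And>i. i \<in> I \<Longrightarrow> 0 \<le> v i \<or> s0 < xs i"
  shows "dotp I (g xs) v \<ge> 0"
proof (rule ccontr)
  \<comment> \<open>Half the slope leaves room for a strict bound at all late iterates.\<close>
  define a where "a = - dotp I (g xs) v / 2"
  define B where "B = \<bar>quad_form I (W xs) (tang xs v)\<bar> + 1"
  assume "\<not> dotp I (g xs) v \<ge> 0"
  then have a: "a > 0" "dotp I (g xs) v < - a" unfolding a_def by auto
  have B: "B > 0" unfolding B_def by simp
  \<comment> \<open>Up to \<open>s1\<close> the linear gain \<open>s * a\<close> covers both the
    curvature term \<open>s\<^sup>2 * B / 2\<close> and the required decrease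
    \<open>s\<^sup>2\<close>.\<close>
  define s1 where "s1 = min s0 (a / (B / 2 + 1))"
  have s1: "0 < s1" "s1 \<le> s0" "s1 \<le> a / (B / 2 + 1)" unfolding s1_def using s0 a B by auto
  have "(\<lambda>t. dotp I (g (x t)) v) \<longlonglongrightarrow> dotp I (g xs) v"
    unfolding dotp_def by (intro tendsto_sum tendsto_mult tendsto_const g_tendsto lim)
  then have "\<forall>\<^sub>F t in sequentially. dotp I (g (x t)) v < - a"
    using a(2) by (rule order_tendstoD)
  moreover have "\<forall>\<^sub>F t in sequentially. quad_form I (W (x t)) (tang (x t) v) < B"
    by (rule order_tendstoD(2)[OF quad_form_tang_tendsto]) (simp add: B_def)
  ultimately have ev: "\<forall>\<^sub>F t in sequentially. \<forall>s. 0 \<le> s \<longrightarrow> s \<le> s1 \<longrightarrow>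
       s * dotp I (g (x t)) v + s\<^sup>2 * quad_form I (W (x t)) (tang (x t) v) / 2 \<le> - 1 * s\<^sup>2"
  proof eventually_elim
    case (elim t)
    show ?case
    proof (intro allI impI)
      fix s assume s: "0 \<le> s" "s \<le> s1"
      have "s \<le> a / (B / 2 + 1)" using s s1 by simp
      then have "s * (B / 2 + 1) \<le> a" using B by (simp add: pos_le_divide_eq)
      then have "s * (s * (B / 2 + 1)) \<le> s * a" using s(1) by (rule mult_left_mono)
      moreover have "s * dotp I (g (x t)) v \<le> s * - a"
        using elim(1) s(1) by (intro mult_left_mono) auto
      moreover have "s\<^sup>2 * quad_form I (W (x t)) (tang (x t) v) \<le> s\<^sup>2 * B"
        using elim(2) by (intro mult_left_mono) auto
      ultimately show "s * dotp I (g (x t)) v + s\<^sup>2 * quad_form I (W (x t)) (tang (x t) v) / 2 \<le> - 1 * s\<^sup>2"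
        by (simp add: power2_eq_square algebra_simps)
    qed
  qed
  have "0 \<le> v i \<or> s1 < xs i" if "i \<in> I" for i
    using pos[OF that] s1(2) by auto
  then show False
    using no_uniform_descent_direction[OF v s1(1) _ _ _ ev] s1(2) s0(2) by simp
qed

text \<open>The linear term is eventually harmless along \<open>v\<close>, so negative curvature at
  the limit alone would give a uniform quadratic decrease.\<close>

lemma no_second_order_descent:
  assumes v: "(\<Sum>i\<in>I. \<bar>v i\<bar>) \<le> 1 / 2" "\<And>i. i \<in> I \<Longrightarrow> 0 \<le> v i"
    and ev: "\<forall>\<^sub>F t in sequentially. dotp I (g (x t)) v \<le> 0"
  shows "quad_form I (W xs) (tang xs v) \<ge> 0"
proof (rule ccontr)
  define q where "q = - quad_form I (W xs) (tang xs v) / 2"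
  assume "\<not> quad_form I (W xs) (tang xs v) \<ge> 0"
  then have q: "q > 0" "quad_form I (W xs) (tang xs v) < - q" unfolding q_def by auto
  have "\<forall>\<^sub>F t in sequentially. quad_form I (W (x t)) (tang (x t) v) < - q"
    by (rule order_tendstoD(2)[OF quad_form_tang_tendsto q(2)])
  then have "\<forall>\<^sub>F t in sequentially. \<forall>s. 0 \<le> s \<longrightarrow> s \<le> 1 \<longrightarrow>
       s * dotp I (g (x t)) v + s\<^sup>2 * quad_form I (W (x t)) (tang (x t) v) / 2 \<le> - (q / 2) * s\<^sup>2"
    using ev
  proof eventually_elim
    case (elim t)
    show ?case
    proof (intro allI impI)
      fix s :: real assume s: "0 \<le> s" "s \<le> 1"
      have "s * dotp I (g (x t)) v \<le> 0"
        using elim(2) s(1) by (rule mult_nonneg_nonpos[rotated])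
      moreover have "s\<^sup>2 * quad_form I (W (x t)) (tang (x t) v) \<le> s\<^sup>2 * - q"
        using elim(1) by (intro mult_left_mono) auto
      ultimately show "s * dotp I (g (x t)) v + s\<^sup>2 * quad_form I (W (x t)) (tang (x t) v) / 2 \<le> - (q / 2) * s\<^sup>2"
        by (simp add: mult.commute)
    qed
  qed
  then show False
    using no_uniform_descent_direction[OF v(1), of 1 "q / 2"] v(2) q(1) by simp
qed

section \<open>Gradient and Hessian at the limit\<close>

text \<open>Where \<open>xs i > 0\<close>, both signs of the coordinate direction are admissible.
  Where \<open>xs i = 0\<close>, only the positive one is, and the upper bound comes from
  \<open>W_mult_self\<close>, whose sum has nonpositive terms.\<close>

lemma g_limit_zero:
  assumes i: "i \<in> I"
  shows "g xs i = 0"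
proof (rule antisym)
  have nn: "0 \<le> xs l" if "l \<in> I" for l using feas_limit that by (simp add: feas_def)
  have sgn: "0 \<le> a * g xs i"
    if "\<bar>a\<bar> \<le> 1 / 2" "0 < s0" "s0 \<le> 1" "0 \<le> a \<or> s0 < xs i" for a s0
  proof -
    let ?v = "\<lambda>l. if l = i then a else 0"
    have "(\<Sum>l\<in>I. \<bar>?v l\<bar>) = (\<Sum>l\<in>I. if l = i then \<bar>a\<bar> else 0)" by (intro sum.cong) auto
    then have "(\<Sum>l\<in>I. \<bar>?v l\<bar>) \<le> 1 / 2" using finite_I i that(1) by simp
    then have "0 \<le> dotp I (g xs) ?v"
      using no_first_order_descent[of ?v s0] that(2-4) by auto
    also have "dotp I (g xs) ?v = (\<Sum>l\<in>I. if l = i then a * g xs i else 0)"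
      unfolding dotp_def by (intro sum.cong) auto
    finally show ?thesis using finite_I i by simp
  qed
  show "0 \<le> g xs i" using sgn[of "1 / 2" 1] by simp
  show "g xs i \<le> 0"
  proof (cases "xs i = 0")
    case True
    have "(\<Sum>l\<in>I. W xs i l * xs l) \<le> 0"
    proof (rule sum_nonpos)
      fix l assume "l \<in> I"
      then show "W xs i l * xs l \<le> 0"
        using W_off_diag[OF i _ _ nn] nn True by (cases "l = i") (auto intro: mult_nonpos_nonneg)
    qed
    then show ?thesis
      unfolding W_mult_self[OF i] using k_ge_3 by (simp add: mult_le_0_iff)
  next
    case False
    then have "0 < xs i" using nn[OF i] by simp
    then show ?thesis using sgn[of "- 1 / 2" "min 1 (xs i / 2)"] by auto
  qed
qed

lemma W_limit_support:
  assumes i: "i \<in> I" and l: "l \<in> I" and z: "xs i = 0"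
  shows "W xs i l = 0"
proof -
  have nn: "0 \<le> xs l" if "l \<in> I" for l using feas_limit that by (simp add: feas_def)
  consider "l = i" | "l \<noteq> i" "xs l > 0" | "l \<noteq> i" "xs l = 0" using nn[OF l] by fastforce
  then show ?thesis
  proof cases
    case 1
    then show ?thesis using W_diag_zero[of i xs, OF i z] by simp
  next
    case 2
    \<comment> \<open>These nonpositive terms sum to \<open>(real k - 1) * g xs i = 0\<close>, so
      each is zero, and \<open>xs l > 0\<close> can be cancelled.\<close>
    have np: "W xs i a * xs a \<le> 0" if "a \<in> I" for a
      using W_off_diag[OF i that _ nn] nn that z by (cases "a = i") (auto intro: mult_nonpos_nonneg)
    have "(\<Sum>a\<in>I. - (W xs i a * xs a)) = 0"
      using W_mult_self[OF i] g_limit_zero[OF i] by (simp add: sum_negf)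
    then have "\<forall>a\<in>I. - (W xs i a * xs a) = 0"
      using finite_I np by (subst (asm) sum_nonneg_eq_0_iff) auto
    then show ?thesis using l 2 by auto
  next
    case 3
    have le: "W xs i l \<le> 0" using W_off_diag[OF i l _ nn] 3 by simp
    show ?thesis
    proof (rule ccontr)
      assume "W xs i l \<noteq> 0"
      then have neg: "W xs i l < 0" using le by simp
      \<comment> \<open>A quarter of the sum of the two unit vectors: the weight makes the absolute
        values sum to the permitted 1/2.\<close>
      let ?v = "\<lambda>a. if a = i \<or> a = l then 1 / 4 else (0::real)"
      have sum_v: "(\<Sum>a\<in>I. h a * ?v a) = (h i + h l) / 4" for h :: "nat \<Rightarrow> real"
      proof -
        have "(\<Sum>a\<in>I. h a * ?v a) = (\<Sum>a\<in>I. (if a = i then h i / 4 else 0) + (if a = l then h l / 4 else 0))"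
          using 3(1) by (intro sum.cong) auto
        then show ?thesis using finite_I i l by (simp add: sum.distrib)
      qed
      have W: "(\<lambda>t. W (x t) a b) \<longlonglongrightarrow> W xs a b" if "a \<in> I" "b \<in> I" for a b
        using W_tendsto[OF lim that] .
      have "(\<lambda>t. W (x t) i i + W (x t) i l) \<longlonglongrightarrow> 0 + W xs i l"
        using tendsto_add[OF W[OF i i] W[OF i l]] W_diag_zero[of i xs, OF i z] by simp
      moreover have "(\<lambda>t. W (x t) l l + W (x t) l i) \<longlonglongrightarrow> 0 + W xs i l"
        using tendsto_add[OF W[OF l l] W[OF l i]] W_diag_zero[of l xs, OF l 3(2)] W_sym[OF i l] by simp
      ultimately have "\<forall>\<^sub>F t in sequentially. W (x t) i i + W (x t) i l < 0 \<and> W (x t) l l + W (x t) l i < 0"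
        using neg by (intro eventually_conj order_tendstoD(2)) auto
      then have ev: "\<forall>\<^sub>F t in sequentially. dotp I (g (x t)) ?v \<le> 0"
      proof eventually_elim
        case (elim t)
        have xt: "0 \<le> x t a" if "a \<in> I" for a using feas_iterate[of t] that by (simp add: feas_def)
        \<comment> \<open>All terms of \<open>W_mult_self\<close> other than \<open>a\<close> and
          \<open>b\<close> are off-diagonal, hence nonpositive, and are dropped.\<close>
        have bound: "(real k - 1) * g (x t) a \<le> (W (x t) a a * x t a + W (x t) a b * x t b)"
          if ab: "a \<in> I" "b \<in> I" "a \<noteq> b" for a b
        proof -
          have "(\<Sum>e\<in>I. W (x t) a e * x t e) \<le> (\<Sum>e\<in>I. (if e = a then W (x t) a a * x t a else 0)
              + (if e = b then W (x t) a b * x t b else 0))"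
            using W_off_diag[OF ab(1) _ _ xt] xt ab
            by (intro sum_mono) (auto intro: mult_nonpos_nonneg)
          then show ?thesis
            unfolding W_mult_self[OF ab(1)] using finite_I ab by (simp add: sum.distrib)
        qed
        \<comment> \<open>Regrouped by coordinate: each coefficient tends to the negative
          \<open>W xs i l\<close>, because the diagonal entries tend to zero.\<close>
        have "(real k - 1) * (g (x t) i + g (x t) l)
            \<le> (W (x t) i i + W (x t) l i) * x t i + (W (x t) l l + W (x t) i l) * x t l"
          using bound[OF i l] bound[OF l i] 3(1) by (simp add: algebra_simps)
        also have "\<dots> \<le> 0"
          using elim xt[OF i] xt[OF l] W_sym[OF i l, of "x t"]
          by (intro add_nonpos_nonpos[OF mult_nonpos_nonneg mult_nonpos_nonneg]) auto
        finally show ?case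
          unfolding dotp_def sum_v using k_ge_3 by (simp add: mult_le_0_iff)
      qed
      \<comment> \<open>Both coordinates of \<open>xs\<close> vanish, so \<open>?v\<close> is
        already tangential at the limit.\<close>
      have "dotp I (grad c xs) ?v = 0"
        unfolding dotp_grad_c sum_v using z 3(2) k_ge_3 by simp
      then have tv: "tang xs ?v = ?v" by (simp add: tang_def)
      have "(\<Sum>a\<in>I. \<bar>?v a\<bar>) = (\<Sum>a\<in>I. 1 * ?v a)" by (intro sum.cong) auto
      then have "(\<Sum>a\<in>I. \<bar>?v a\<bar>) \<le> 1 / 2" unfolding sum_v by simp
      then have "quad_form I (W xs) (tang xs ?v) \<ge> 0"
        using ev by (intro no_second_order_descent) simp_all
      also have "quad_form I (W xs) (tang xs ?v) = (\<Sum>a\<in>I. (\<Sum>b\<in>I. W xs a b * ?v b) * ?v a)"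
        unfolding tv quad_form_def sum_distrib_right by (intro sum.cong refl) (simp add: mult_ac)
      \<comment> \<open>The diagonal contributions vanish; the two cross terms give
        \<open>W xs i l / 16\<close> each.\<close>
      also have "\<dots> = W xs i l / 8"
        unfolding sum_v using W_diag_zero[of i xs, OF i z] W_diag_zero[of l xs, OF l 3(2)] W_sym[OF i l, of xs] by simp
      finally show False using neg by simp
    qed
  qed
qed

text \<open>The Z-matrix lemma applies with null vector \<open>xs\<close>: by
  \<open>W_mult_self\<close>, a vanishing \<open>g xs\<close> means that \<open>W xs\<close>
  annihilates \<open>xs\<close>.\<close>

lemma quad_form_limit_nonneg: "quad_form I (W xs) v \<ge> 0"
proof (rule quad_form_Z_matrix_nonneg[where x = xs])
  show nn: "0 \<le> xs i" if "i \<in> I" for i using feas_limit that by (simp add: feas_def)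
  show "W xs i l \<le> 0" if "i \<in> I" "l \<in> I" "i \<noteq> l" for i l
    using W_off_diag[OF that nn] by simp
  show "(\<Sum>l\<in>I. W xs i l * xs l) = 0" if "i \<in> I" for i
    using W_mult_self[OF that] g_limit_zero[OF that] by simp
qed (simp_all add: W_sym W_limit_support)

end

theorem theorem5p7:
  fixes n k j :: nat
    and E :: "nat set set"
    and I :: "nat set"
    and f c :: "(nat \<Rightarrow> real) \<Rightarrow> real"
    and \<sigma>0 \<sigma>1 \<sigma>2 \<Delta>max \<epsilon> :: real
    and x d :: "nat \<Rightarrow> nat \<Rightarrow> real"
    and \<Delta> :: "nat \<Rightarrow> real"
    and xs :: "nat \<Rightarrow> real"
    and lam :: real
  assumes "k \<ge> 3"
    and "uniform_hypergraph n k E"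
    and "j \<in> {1..n}"
    and "I = {1..n} - {j}"
    and "f = lap_fun k E I"
    and "c = sphere_con k I"
    and "0 < \<sigma>0" and "\<sigma>0 < \<sigma>1" and "\<sigma>1 < \<sigma>2" and "\<sigma>1 < 1"
    and "0 \<le> \<epsilon>"
    and "ftr_run k I f c \<sigma>0 \<sigma>1 \<sigma>2 \<Delta>max \<epsilon> x d \<Delta>"
    and "\<And>i. i \<in> I \<Longrightarrow> (\<lambda>t. x t i) \<longlonglongrightarrow> xs i"
    and "lam = multiplier I f xs"
  shows "\<forall>v \<in> critical_cone I f c xs lam. quad_form I (lag_hess f c lam xs) v \<ge> 0"
proof -
  interpret ftr k E I \<sigma>0 \<sigma>1 \<sigma>2 \<Delta>max \<epsilon> x d \<Delta> xs
  proof unfold_locales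
    show "finite I" using assms(4) by simp
    show "card e = k" if "e \<in> E" for e
      using assms(2) that by (simp add: uniform_hypergraph_def)
    show "ftr_run k I (lap_fun k E I) (sphere_con k I) \<sigma>0 \<sigma>1 \<sigma>2 \<Delta>max \<epsilon> x d \<Delta>"
      using assms(5,6,12) by simp
  qed (use assms in auto)
  show ?thesis
    using quad_form_limit_nonneg assms(5,6,14) by simp
qed

end
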